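(* For each $n\geq1$ let $\mathcal{P}_n$ be the finite set of plane partitions of size $n$ with the uniform probability measure, and let $X_n^+(\pi)=w_+(\pi)/n^{2/3}$ and $X_n^-(\pi)=w_-(\pi)/n^{2/3}$. Let $c=1/(2\zeta(3))^{1/3}$. Then as $n\to\infty$, the random variable $X_n^+-X_n^-$ has as limit law the normal distribution $\mathcal{N}(0,c)$ with mean $0$ and variance $c$.
   Context: A plane partition $\pi$ is an array $(\pi_{i,j})_{i,j\geq 0}$ of nonnegative integers, only finitely many nonzero, weakly decreasing in each index. Its size is $|\pi|=\sum_{i,j}\pi_{i,j}$. Here $w_+(\pi)=\sum_{i<j}\pi_{i,j}$ and $w_-(\pi)=\sum_{i>j}\pi_{i,j}$. $\zeta$ is the Riemann zeta function. *)

theory Defs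
  imports "HOL-Probability.Probability"
begin

definition plane_partition :: "(nat \<Rightarrow> nat \<Rightarrow> nat) \<Rightarrow> bool" where
  "plane_partition p \<longleftrightarrow>
     finite {(i, j). p i j \<noteq> 0} \<and>
     (\<forall>i j. p (Suc i) j \<le> p i j) \<and> (\<forall>i j. p i (Suc j) \<le> p i j)"

definition pp_size :: "(nat \<Rightarrow> nat \<Rightarrow> nat) \<Rightarrow> nat" where
  "pp_size p = (\<Sum>(i, j) \<in> {(i, j). p i j \<noteq> 0}. p i j)"

definition w_plus :: "(nat \<Rightarrow> nat \<Rightarrow> nat) \<Rightarrow> nat" where
  "w_plus p = (\<Sum>(i, j) \<in> {(i, j). i < j \<and> p i j \<noteq> 0}. p i j)"

definition w_minus :: "(nat \<Rightarrow> nat \<Rightarrow> nat) \<Rightarrow> nat" where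
  "w_minus p = (\<Sum>(i, j) \<in> {(i, j). i > j \<and> p i j \<noteq> 0}. p i j)"

definition plane_partitions :: "nat \<Rightarrow> (nat \<Rightarrow> nat \<Rightarrow> nat) set" where
  "plane_partitions n = {p. plane_partition p \<and> pp_size p = n}"

definition zeta3 :: real where
  "zeta3 = (\<Sum>k. 1 / (real (Suc k)) ^ 3)"

definition pp_diff_law :: "nat \<Rightarrow> real measure" where
  "pp_diff_law n = distr (measure_pmf (pmf_of_set (plane_partitions n))) borel
      (\<lambda>p. real (w_plus p) / real n powr (2/3) - real (w_minus p) / real n powr (2/3))"

end

theory Submission
  imports Defs
begin

text \<open>
  Growth diagrams for the local rule of the RSK correspondence give a bijection between plane partitions
  of size \<open>n\<close> and families of natural numbers \<open>H (a, b)\<close> with \<open>\<Sum> (a + b + 1) * H (a, b) = n\<close>,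
  under which \<open>w_plus\<close> is \<open>\<Sum> b * H (a, b)\<close> and \<open>w_minus\<close> is \<open>\<Sum> a * H (a, b)\<close>.
  Hence the characteristic function of \<open>w_plus - w_minus\<close> at \<open>\<theta>\<close> is a ratio of Fourier coefficients of
  finite products of factors \<open>1 / (1 - e^(- \<tau> m) e^(\<i> (\<alpha> m + \<theta> (b - a))))\<close> with \<open>m = a + b + 1\<close>.
  Choose \<open>\<tau> > 0\<close> so that the expected size is \<open>n\<close>; a Riemann sum argument gives
  \<open>n \<tau>^3 \<longlonglongrightarrow> 2 \<zeta>(3)\<close>. With \<open>\<alpha> = u \<tau>^2\<close> and \<open>\<theta> = v \<tau>^2\<close> the normalised integrand converges to
  \<open>exp (- 3 \<zeta>(3) (u^2 + v^2 / 3))\<close> and is dominated by \<open>K exp (- k \<bar>u\<bar>)\<close> on the whole range of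
  integration, so dominated convergence and Levy's continuity theorem finish the proof.
\<close>

subsection \<open>Growth diagrams\<close>

text \<open>Passing to a quotient of Fourier coefficients cancels the prefactor, and with it any
  need for the asymptotic number of plane partitions. The scale \<tau>^2 is the reciprocal order of
  the standard deviation of the size, and it matches n^(-2/3) because n \<tau>^3 converges.
  Transposition symmetry makes b - a sum to zero along each antidiagonal, so u and v do not interact
  in the quadratic form; the factor 1/3 is the limiting mean of (b - a)^2 / m^2 over an antidiagonal
  with m cells. With v = t / (2 \<zeta>(3))^(2/3) the surviving factor exp (- \<zeta>(3) v^2) is exp
  (- c t^2 / 2). The obstacle is the range where \<alpha> is of order 1: there u is of order
  \<tau>^(-2), and the integrand is only shown to be at most exp (- const \<tau>^(-2)), so the
  common majorant is exponential in u and not Gaussian. What makes it uniform in \<alpha> is a lower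
  bound for sums of 1 - cos (\<alpha> m) over a block of hook lengths.\<close>

text \<open>Partitions are weakly decreasing functions \<open>nat \<Rightarrow> nat\<close> with finite support; \<open>interlace \<mu> \<rho>\<close> says
  that \<open>\<rho> / \<mu>\<close> is a horizontal strip.\<close>

definition interlace :: "(nat \<Rightarrow> nat) \<Rightarrow> (nat \<Rightarrow> nat) \<Rightarrow> bool" where
  "interlace \<mu> \<rho> \<longleftrightarrow> (\<forall>k. \<mu> k \<le> \<rho> k \<and> \<rho> (Suc k) \<le> \<mu> k)"

text \<open>The local rule of the RSK correspondence in piecewise linear form: given \<open>\<kappa>\<close> interlacing with
  both \<open>\<mu>\<close> and \<open>\<nu>\<close>, the pairs \<open>(g, \<kappa>)\<close> correspond to the \<open>\<rho>\<close> that \<open>\<mu>\<close> and \<open>\<nu>\<close> interlace with, and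
  \<open>\<bar>\<rho>\<bar> + \<bar>\<kappa>\<bar> = \<bar>\<mu>\<bar> + \<bar>\<nu>\<bar> + g\<close>.\<close>

definition grow :: "nat \<Rightarrow> (nat \<Rightarrow> nat) \<Rightarrow> (nat \<Rightarrow> nat) \<Rightarrow> (nat \<Rightarrow> nat) \<Rightarrow> nat \<Rightarrow> nat" where
  "grow g \<kappa> \<mu> \<nu> k = (case k of 0 \<Rightarrow> max (\<mu> 0) (\<nu> 0) + g
     | Suc l \<Rightarrow> max (\<mu> (Suc l)) (\<nu> (Suc l)) + min (\<mu> l) (\<nu> l) - \<kappa> l)"

text \<open>The local rule amounts to \<open>\<rho> (Suc k) + \<kappa> k = max (\<mu> (Suc k))
  (\<nu> (Suc k)) + min (\<mu> k) (\<nu> k)\<close>, which is symmetric in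
  \<open>\<rho> (Suc k)\<close> and \<open>\<kappa> k\<close>. Its inverse therefore has the same
  shape, and \<open>g\<close> is what \<open>\<rho> 0\<close> has beyond
  \<open>max (\<mu> 0) (\<nu> 0)\<close>.\<close>

definition shrink :: "(nat \<Rightarrow> nat) \<Rightarrow> (nat \<Rightarrow> nat) \<Rightarrow> (nat \<Rightarrow> nat) \<Rightarrow> nat \<Rightarrow> nat" where
  "shrink \<mu> \<nu> \<rho> k = max (\<mu> (Suc k)) (\<nu> (Suc k)) + min (\<mu> k) (\<nu> k) - \<rho> (Suc k)"

lemma grow_simps [simp]:
  "grow g \<kappa> \<mu> \<nu> 0 = max (\<mu> 0) (\<nu> 0) + g"
  "grow g \<kappa> \<mu> \<nu> (Suc l) = max (\<mu> (Suc l)) (\<nu> (Suc l)) + min (\<mu> l) (\<nu> l) - \<kappa> l"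
  by (simp_all add: grow_def)

text \<open>Interlacing puts \<open>\<kappa> l\<close> between
  \<open>max (\<mu> (Suc l)) (\<nu> (Suc l))\<close> and \<open>min (\<mu> l) (\<nu> l)\<close>.
  Hence the natural subtraction in \<open>grow\<close> never truncates and the new part lies between
  the same two bounds.\<close>

lemma interlace_grow:
  assumes "interlace \<kappa> \<mu>" "interlace \<kappa> \<nu>"
  shows "interlace \<mu> (grow g \<kappa> \<mu> \<nu>)" "interlace \<nu> (grow g \<kappa> \<mu> \<nu>)"
proof -
  have k: "\<kappa> k \<le> \<mu> k" "\<mu> (Suc k) \<le> \<kappa> k" "\<kappa> k \<le> \<nu> k" "\<nu> (Suc k) \<le> \<kappa> k" for k
    using assms by (auto simp: interlace_def)
  have "\<mu> k \<le> grow g \<kappa> \<mu> \<nu> k \<and> \<nu> k \<le> grow g \<kappa> \<mu> \<nu> k" for k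
    using k[of "k - 1"] by (cases k) auto
  moreover have "grow g \<kappa> \<mu> \<nu> (Suc k) \<le> \<mu> k \<and> grow g \<kappa> \<mu> \<nu> (Suc k) \<le> \<nu> k" for k
    using k[of k] by auto
  ultimately show "interlace \<mu> (grow g \<kappa> \<mu> \<nu>)" "interlace \<nu> (grow g \<kappa> \<mu> \<nu>)"
    by (auto simp: interlace_def)
qed

lemma interlace_shrink:
  assumes "interlace \<mu> \<rho>" "interlace \<nu> \<rho>"
  shows "interlace (shrink \<mu> \<nu> \<rho>) \<mu>" "interlace (shrink \<mu> \<nu> \<rho>) \<nu>"
proof -
  have k: "\<mu> k \<le> \<rho> k" "\<rho> (Suc k) \<le> \<mu> k" "\<nu> k \<le> \<rho> k" "\<rho> (Suc k) \<le> \<nu> k" for k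
    using assms by (auto simp: interlace_def)
  have "shrink \<mu> \<nu> \<rho> k \<le> min (\<mu> k) (\<nu> k)" "max (\<mu> (Suc k)) (\<nu> (Suc k)) \<le> shrink \<mu> \<nu> \<rho> k" for k
    using k(1,3)[of "Suc k"] k(2,4)[of k] unfolding shrink_def by linarith+
  then show "interlace (shrink \<mu> \<nu> \<rho>) \<mu>" "interlace (shrink \<mu> \<nu> \<rho>) \<nu>"
    unfolding interlace_def by simp_all
qed

lemma shrink_grow:
  assumes "interlace \<kappa> \<mu>" "interlace \<kappa> \<nu>"
  shows "shrink \<mu> \<nu> (grow g \<kappa> \<mu> \<nu>) = \<kappa>"
proof
  fix k
  have "\<kappa> k \<le> \<mu> k" "\<kappa> k \<le> \<nu> k"
    using assms by (auto simp: interlace_def)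
  then show "shrink \<mu> \<nu> (grow g \<kappa> \<mu> \<nu>) k = \<kappa> k"
    by (auto simp: shrink_def)
qed

lemma grow_shrink:
  assumes "interlace \<mu> \<rho>" "interlace \<nu> \<rho>"
  shows "grow (\<rho> 0 - max (\<mu> 0) (\<nu> 0)) (shrink \<mu> \<nu> \<rho>) \<mu> \<nu> = \<rho>"
proof
  fix k
  have k: "\<mu> k \<le> \<rho> k" "\<rho> (Suc k) \<le> \<mu> k" "\<nu> k \<le> \<rho> k" "\<rho> (Suc k) \<le> \<nu> k" for k
    using assms by (auto simp: interlace_def)
  show "grow (\<rho> 0 - max (\<mu> 0) (\<nu> 0)) (shrink \<mu> \<nu> \<rho>) \<mu> \<nu> k = \<rho> k"
    using k[of "k - 1"] k[of k] by (cases k) (auto simp: shrink_def)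
qed

text \<open>A Fomin growth diagram with empty shapes on the two inner edges:
  \<open>growth G i j\<close> is the RSK shape of the submatrix of entries \<open>G a b\<close> with
  \<open>a < i\<close> and \<open>b < j\<close>.\<close>

fun growth :: "(nat \<Rightarrow> nat \<Rightarrow> nat) \<Rightarrow> nat \<Rightarrow> nat \<Rightarrow> nat \<Rightarrow> nat" where
  "growth G 0 j = (\<lambda>_. 0)"
| "growth G (Suc i) 0 = (\<lambda>_. 0)"
| "growth G (Suc i) (Suc j) = grow (G i j) (growth G i j) (growth G (Suc i) j) (growth G i (Suc j))"

lemma growth_0_right [simp]: "growth G i 0 = (\<lambda>_. 0)"
  by (cases i) auto

text \<open>In the local rule only the minimum could survive at this position, and there one of the
  two neighbouring shapes has already run out of parts.\<close>

lemma growth_eq_0: "min i j \<le> k \<Longrightarrow> growth G i j k = 0"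
proof (induction G i j arbitrary: k rule: growth.induct)
  case (3 G i j)
  then obtain l where [simp]: "k = Suc l" by (cases k) auto
  from 3(4) have "min i j \<le> l" by auto
  then have "growth G (Suc i) j (Suc l) = 0" "growth G i (Suc j) (Suc l) = 0"
    "growth G (Suc i) j l = 0 \<or> growth G i (Suc j) l = 0"
    using 3(2)[of "Suc l"] 3(3)[of "Suc l"] 3(2)[of l] 3(3)[of l] by (auto simp: min_def split: if_splits)
  then show ?case by auto
qed auto

lemma interlace_growth:
  "interlace (growth G i j) (growth G (Suc i) j) \<and> interlace (growth G i j) (growth G i (Suc j))"
proof (induction G i j rule: growth.induct)
  case (3 G i j)
  then show ?case
    using interlace_grow by simp
qed (auto simp: interlace_def growth_eq_0)

text \<open>As \<open>max x y + min x y = x + y\<close>, summing the local rule over all parts gives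
  inclusion-exclusion for the sizes of the four shapes around a cell, the same recursion as for
  rectangular sums of \<open>G\<close>. The bound \<open>i \<le> K\<close> ensures that no part is
  cut off.\<close>

lemma sum_growth:
  "i \<le> K \<Longrightarrow> (\<Sum>k<K. growth G i j k) = (\<Sum>a<i. \<Sum>b<j. G a b)"
proof (induction G i j rule: growth.induct)
  case (3 G i j)
  let ?\<kappa> = "growth G i j" and ?\<mu> = "growth G (Suc i) j" and ?\<nu> = "growth G i (Suc j)"
  obtain N where K: "K = Suc N" using 3 by (cases K) auto
  then have iN: "i \<le> N" using 3 by auto
  have le: "?\<kappa> k \<le> ?\<mu> k" "?\<kappa> k \<le> ?\<nu> k" for k
    using interlace_growth[of G i j] by (auto simp: interlace_def)
  have "(\<Sum>k<K. growth G (Suc i) (Suc j) k) + (\<Sum>k<N. ?\<kappa> k)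
     = max (?\<mu> 0) (?\<nu> 0) + G i j + (\<Sum>k<N. max (?\<mu> (Suc k)) (?\<nu> (Suc k)) + min (?\<mu> k) (?\<nu> k) - ?\<kappa> k + ?\<kappa> k)"
    unfolding K sum.lessThan_Suc_shift by (simp add: sum.distrib)
  also have "(\<Sum>k<N. max (?\<mu> (Suc k)) (?\<nu> (Suc k)) + min (?\<mu> k) (?\<nu> k) - ?\<kappa> k + ?\<kappa> k)
      = (\<Sum>k<N. max (?\<mu> (Suc k)) (?\<nu> (Suc k)) + min (?\<mu> k) (?\<nu> k))"
    using le by (intro sum.cong refl) (simp add: trans_le_add2)
  also have "max (?\<mu> 0) (?\<nu> 0) + G i j + \<dots> = G i j + (\<Sum>k<K. max (?\<mu> k) (?\<nu> k)) + (\<Sum>k<N. min (?\<mu> k) (?\<nu> k))"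
    unfolding K sum.lessThan_Suc_shift by (simp add: sum.distrib)
  also have "(\<Sum>k<N. min (?\<mu> k) (?\<nu> k)) = (\<Sum>k<K. min (?\<mu> k) (?\<nu> k))"
    using growth_eq_0[of i "Suc j" N G] iN by (simp add: K)
  also have "G i j + (\<Sum>k<K. max (?\<mu> k) (?\<nu> k)) + (\<Sum>k<K. min (?\<mu> k) (?\<nu> k))
     = G i j + (\<Sum>k<K. max (?\<mu> k) (?\<nu> k) + min (?\<mu> k) (?\<nu> k))"
    by (simp add: sum.distrib)
  also have "\<dots> = G i j + (\<Sum>k<K. ?\<mu> k) + (\<Sum>k<K. ?\<nu> k)"
    by (simp add: max_def min_def sum.distrib[symmetric] if_distrib cong: if_cong)
       (intro sum.cong, auto)
  also have "(\<Sum>k<N. ?\<kappa> k) = (\<Sum>k<K. ?\<kappa> k)"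
    using growth_eq_0[of i j N G] iN by (simp add: K)
  finally have "(\<Sum>k<K. growth G (Suc i) (Suc j) k) + (\<Sum>a<i. \<Sum>b<j. G a b)
     = G i j + (\<Sum>a<Suc i. \<Sum>b<j. G a b) + (\<Sum>a<i. \<Sum>b<Suc j. G a b)"
    using 3 by simp
  then show ?case by (simp add: sum.distrib)
qed auto

text \<open>The diagram read backwards from its outer corner: \<open>d\<close> and \<open>e\<close>
  are distances from the two outer edges, so the side length does not enter. The edges carry the
  diagonal slices of \<open>p\<close>, on either side of the main diagonal.\<close>

fun ungrowth :: "(nat \<Rightarrow> nat \<Rightarrow> nat) \<Rightarrow> nat \<Rightarrow> nat \<Rightarrow> nat \<Rightarrow> nat" where
  "ungrowth p 0 e = (\<lambda>l. p l (l + e))"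
| "ungrowth p (Suc d) 0 = (\<lambda>l. p (l + Suc d) l)"
| "ungrowth p (Suc d) (Suc e) = shrink (ungrowth p d (Suc e)) (ungrowth p (Suc d) e) (ungrowth p d e)"

lemma ungrowth_0_right [simp]: "ungrowth p d 0 = (\<lambda>l. p (l + d) l)"
  by (cases d) auto

text \<open>The diagonal slices of the plane partition are the partitions along the two outer edges of the
  growth diagram. Truncated subtraction sends slices at distance at least \<open>L\<close> from the main diagonal to
  the empty partition.\<close>

definition pp_of_matrix :: "nat \<Rightarrow> (nat \<Rightarrow> nat \<Rightarrow> nat) \<Rightarrow> nat \<Rightarrow> nat \<Rightarrow> nat" where
  "pp_of_matrix L G i j =
     (if i \<le> j then growth G L (L - (j - i)) i else growth G (L - (i - j)) L j)"

text \<open>Neighbouring diagonal slices interlace because \<open>p\<close> decreases along rows and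
  columns; \<open>interlace_shrink\<close> carries this inwards. Shapes next to an edge need an
  induction along that edge of their own.\<close>

lemma interlace_ungrowth:
  assumes "plane_partition p"
  shows "interlace (ungrowth p (Suc d) e) (ungrowth p d e) \<and> interlace (ungrowth p d (Suc e)) (ungrowth p d e)"
  using assms
proof (induction p d e rule: ungrowth.induct)
  case (1 p e)
  have m: "p (Suc i) j \<le> p i j" "p i (Suc j) \<le> p i j" for i j
    using 1 by (auto simp: plane_partition_def)
  have *: "interlace (ungrowth p 0 (Suc e)) (ungrowth p 0 e)" for e
    using m by (auto simp: interlace_def)
  have "interlace (ungrowth p (Suc 0) e) (ungrowth p 0 e)"
  proof (induction e)
    case 0
    then show ?case using m by (auto simp: interlace_def)
  next
    case (Suc e)
    show ?case using interlace_shrink[OF *[of e] Suc] by simp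
  qed
  then show ?case using * by blast
next
  case (2 p d)
  have m: "p (Suc i) j \<le> p i j" "p i (Suc j) \<le> p i j" for i j
    using 2 by (auto simp: plane_partition_def)
  have *: "interlace (ungrowth p (Suc d) 0) (ungrowth p d 0)" for d
    using m by (auto simp: interlace_def)
  have "interlace (ungrowth p d (Suc 0)) (ungrowth p d 0)" for d
  proof (induction d)
    case 0
    then show ?case using m by (auto simp: interlace_def)
  next
    case (Suc d)
    show ?case using interlace_shrink[OF Suc *[of d]] by simp
  qed
  then show ?case using * by blast
next
  case (3 p d e)
  then show ?case using interlace_shrink by simp
qed

text \<open>\<open>shrink\<close> recovers each shape from its three outer neighbours, so agreement
  on the outer edges spreads inwards. Positions are written as distances from these edges to make
  that the direction of the induction.\<close>

lemma growth_determined: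
  assumes "\<And>j. j \<le> L \<Longrightarrow> growth G L j = growth H L j" "\<And>i. i \<le> L \<Longrightarrow> growth G i L = growth H i L"
  shows "d \<le> L \<Longrightarrow> e \<le> L \<Longrightarrow> growth G (L - d) (L - e) = growth H (L - d) (L - e)"
proof (induction d arbitrary: e)
  case (Suc d)
  from Suc(3) show ?case
  proof (induction e)
    case (Suc e)
    define i j where "i = L - Suc d" and "j = L - Suc e"
    have ij: "L - d = Suc i" "L - e = Suc j" using Suc.prems \<open>Suc d \<le> L\<close> by (auto simp: i_def j_def)
    have s: "growth F i j = shrink (growth F (Suc i) j) (growth F i (Suc j)) (growth F (Suc i) (Suc j))" for F
      using shrink_grow interlace_growth[of F i j] by simp
    have "growth G (Suc i) j = growth H (Suc i) j"
      using \<open>\<And>e. _ \<Longrightarrow> _ \<Longrightarrow> growth G (L - d) (L - e) = growth H (L - d) (L - e)\<close>[of "Suc e"] Suc.prems \<open>Suc d \<le> L\<close>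
      by (simp add: ij j_def)
    moreover have "growth G (Suc i) (Suc j) = growth H (Suc i) (Suc j)"
      using \<open>\<And>e. _ \<Longrightarrow> _ \<Longrightarrow> growth G (L - d) (L - e) = growth H (L - d) (L - e)\<close>[of "e"] Suc.prems \<open>Suc d \<le> L\<close>
      by (simp only: ij)
    moreover have "growth G i (Suc j) = growth H i (Suc j)"
      using Suc by (simp only: ij i_def[symmetric])
    ultimately show ?case
      unfolding i_def[symmetric] j_def[symmetric] by (subst (1 2) s) simp
  qed (use assms in auto)
qed (use assms in auto)

lemma pp_of_matrix_inj:
  assumes "pp_of_matrix L G = pp_of_matrix L H" "a < L" "b < L"
  shows "G a b = H a b"
proof -
  have 1: "growth G L j = growth H L j" if "j \<le> L" for j
  proof
    fix l
    show "growth G L j l = growth H L j l"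
    proof -
      define e where "e = L - j"
      have "L - e = j" using that by (simp add: e_def)
      then show ?thesis
        using fun_cong[OF fun_cong[OF assms(1)], of l "l + e"] by (simp add: pp_of_matrix_def)
    qed
  qed
  have 2: "growth G i L = growth H i L" if "i \<le> L" for i
  proof (cases "i = L")
    case False
    define d where "d = L - i"
    have d: "L - d = i" "0 < d" using that False by (simp_all add: d_def)
    show ?thesis
    proof
      fix l
      show "growth G i L l = growth H i L l"
        using fun_cong[OF fun_cong[OF assms(1)], of "l + d" l] d by (simp add: pp_of_matrix_def)
    qed
  qed (use 1 in simp)
  have *: "growth G i j = growth H i j" if "i \<le> L" "j \<le> L" for i j
    using growth_determined[OF 1 2, of "L - i" "L - j"] that by simp
  \<comment> \<open>The matrix entry is visible in the largest parts of the shapes around its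
    cell.\<close>
  have "growth F (Suc a) (Suc b) 0 = max (growth F (Suc a) b 0) (growth F a (Suc b) 0) + F a b" for F
    by simp
  from this[of G] this[of H] show ?thesis
    using *[of "Suc a" "Suc b"] *[of "Suc a" b] *[of a "Suc b"] assms(2,3) by (simp del: growth.simps)
qed

section \<open>Arrays supported in a square, and surjectivity of the growth map\<close>

definition square_box :: "nat \<Rightarrow> (nat \<Rightarrow> nat \<Rightarrow> nat) set" where
  "square_box L = {G. \<forall>a b. L \<le> a \<or> L \<le> b \<longrightarrow> G a b = 0}"

lemma box_finite_support: "p \<in> square_box L \<Longrightarrow> {(i, j). p i j \<noteq> 0} \<subseteq> {..<L} \<times> {..<L}"
  by (auto simp: square_box_def) (metis leI less_nat_zero_code not_gr_zero)+

lemma pp_of_matrix_box: "pp_of_matrix L G \<in> square_box L"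
  by (auto simp: square_box_def pp_of_matrix_def intro!: growth_eq_0)

text \<open>A step along a row or column leads to a neighbouring diagonal, so each inequality is one
  half of an interlacing relation. The cases separate steps towards and away from the main diagonal,
  and diagonals whose truncated distance is already 0.\<close>

lemma pp_of_matrix_plane_partition: "plane_partition (pp_of_matrix L G)"
proof -
  have il: "growth G i j k \<le> growth G (Suc i) j k" "growth G (Suc i) j (Suc k) \<le> growth G i j k"
     "growth G i j k \<le> growth G i (Suc j) k" "growth G i (Suc j) (Suc k) \<le> growth G i j k" for i j k
    using interlace_growth[of G i j] by (auto simp: interlace_def)
  have z: "growth G 0 j k = 0" "growth G i 0 k = 0" for i j k by auto
  have r: "pp_of_matrix L G i (Suc j) \<le> pp_of_matrix L G i j" for i j
  proof (cases "i \<le> j")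
    case True
    show ?thesis
    proof (cases "j - i < L")
      case l: True
      then have "L - (j - i) = Suc (L - (Suc j - i))" using True by auto
      then show ?thesis using True il(3)[of L "L - (Suc j - i)" i] by (simp add: pp_of_matrix_def)
    qed (use True in \<open>auto simp: pp_of_matrix_def\<close>)
  next
    case False
    show ?thesis
    proof (cases "i - j \<le> L")
      case l: True
      then have e: "L - (i - Suc j) = Suc (L - (i - j))" using False by auto
      have "growth G (Suc (L - (i - j))) L (Suc j) \<le> growth G (L - (i - j)) L j" by (rule il)
      moreover have "pp_of_matrix L G i (Suc j) = growth G (L - (i - Suc j)) L (Suc j)"
        using False by (cases "i = Suc j") (auto simp: pp_of_matrix_def)
      ultimately show ?thesis using False e by (simp add: pp_of_matrix_def)
    next
      case l: False
      then have "pp_of_matrix L G i (Suc j) = 0"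
        using pp_of_matrix_box[of L G] by (auto simp: square_box_def)
      then show ?thesis by simp
    qed
  qed
  have c: "pp_of_matrix L G (Suc i) j \<le> pp_of_matrix L G i j" for i j
  proof (cases "i < j")
    case True
    show ?thesis
    proof (cases "j - i \<le> L")
      case l: True
      then have e: "L - (j - Suc i) = Suc (L - (j - i))" using True by auto
      have "growth G L (Suc (L - (j - i))) (Suc i) \<le> growth G L (L - (j - i)) i" by (rule il)
      then show ?thesis using True e by (simp add: pp_of_matrix_def)
    next
      case l: False
      then have "pp_of_matrix L G (Suc i) j = 0"
        using pp_of_matrix_box[of L G] by (auto simp: square_box_def)
      then show ?thesis by simp
    qed
  next
    case False
    have pe: "pp_of_matrix L G i j = growth G (L - (i - j)) L j"
      using False by (cases "i = j") (auto simp: pp_of_matrix_def)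
    show ?thesis
    proof (cases "i - j < L")
      case l: True
      then have "L - (i - j) = Suc (L - (Suc i - j))" using False by auto
      then show ?thesis using False il(1)[of "L - (Suc i - j)" L j] pe by (simp add: pp_of_matrix_def)
    qed (use False in \<open>auto simp: pp_of_matrix_def\<close>)
  qed
  show ?thesis
    unfolding plane_partition_def
    using r c finite_subset[OF box_finite_support[OF pp_of_matrix_box[of L G]]] by auto
qed

lemma pp_of_matrix_surj:
  assumes p: "plane_partition p" "p \<in> square_box L"
  shows "\<exists>G \<in> square_box L. pp_of_matrix L G = p"
proof -
  \<comment> \<open>This is the value of \<open>g\<close> that \<open>grow_shrink\<close> requires
    in the cell \<open>(a, b)\<close>.\<close>
  define G where "G a b = (if a < L \<and> b < L then
     ungrowth p (L - Suc a) (L - Suc b) 0 -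
     max (ungrowth p (L - Suc a) (L - b) 0) (ungrowth p (L - a) (L - Suc b) 0) else 0)" for a b
  \<comment> \<open>Slices at distance \<open>L\<close> are empty because \<open>p\<close> lies in
    the box; interlacing then keeps the whole inner edge empty, which matches the initial values of
    \<open>growth\<close>.\<close>
  have u1: "ungrowth p L e = (\<lambda>_. 0)" for e
  proof (induction e)
    case 0
    then show ?case using p by (auto simp: square_box_def)
  next
    case (Suc e)
    then show ?case using interlace_ungrowth[OF p(1), of L e] by (auto simp: interlace_def)
  qed
  have u2: "ungrowth p d L = (\<lambda>_. 0)" for d
  proof (induction d)
    case 0
    then show ?case using p by (auto simp: square_box_def)
  next
    case (Suc d)
    then show ?case using interlace_ungrowth[OF p(1), of d L] by (auto simp: interlace_def)
  qed
  have *: "i \<le> L \<Longrightarrow> j \<le> L \<Longrightarrow> growth G i j = ungrowth p (L - i) (L - j)" for i j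
  proof (induction i arbitrary: j)
    case (Suc i)
    note IH = Suc(1)
    from Suc(3) show ?case
    proof (induction j)
      case (Suc j)
      define d e where "d = L - Suc i" and "e = L - Suc j"
      have ij: "L - i = Suc d" "L - j = Suc e" using Suc.prems \<open>Suc i \<le> L\<close> by (auto simp: d_def e_def)
      have 1: "growth G i j = ungrowth p (Suc d) (Suc e)" "growth G i (Suc j) = ungrowth p (Suc d) e"
        "growth G (Suc i) j = ungrowth p d (Suc e)"
        using IH[of j] IH[of "Suc j"] Suc \<open>Suc i \<le> L\<close> by (simp_all only: ij d_def e_def)
      have 2: "G i j = ungrowth p d e 0 - max (ungrowth p d (Suc e) 0) (ungrowth p (Suc d) e 0)"
        using Suc.prems \<open>Suc i \<le> L\<close> unfolding G_def ij d_def[symmetric] e_def[symmetric] by auto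
      show ?case
        using grow_shrink[of "ungrowth p d (Suc e)" "ungrowth p d e" "ungrowth p (Suc d) e"]
          interlace_ungrowth[OF p(1), of d e]
        unfolding growth.simps(3) 1 2 d_def[symmetric] e_def[symmetric] by simp
    qed (use u2 in auto)
  qed (use u1 in auto)
  have "pp_of_matrix L G i j = p i j" for i j
  proof (cases "i \<ge> L \<or> j \<ge> L")
    case True
    then show ?thesis using p(2) pp_of_matrix_box[of L G] by (auto simp: square_box_def)
  next
    case False
    then show ?thesis using *[of L "L - (j - i)"] *[of "L - (i - j)" L]
      by (auto simp: pp_of_matrix_def)
  qed
  moreover have "G \<in> square_box L" by (auto simp: square_box_def G_def)
  ultimately show ?thesis by blast
qed

subsection \<open>Cell counts of plane partitions\<close>

lemma square_boxD: "p \<in> square_box L \<Longrightarrow> p i j \<noteq> 0 \<Longrightarrow> i < L \<and> j < L"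
  unfolding square_box_def by (metis (mono_tags, lifting) mem_Collect_eq not_le)

lemma w_plus_box:
  assumes "p \<in> square_box L"
  shows "w_plus p = (\<Sum>e=1..<L. \<Sum>l<L. p l (l + e))"
proof -
  define T where "T = {x \<in> {1..<L} \<times> {..<L}. p (snd x) (snd x + fst x) \<noteq> 0}"
  have "w_plus p = (\<Sum>x\<in>T. p (snd x) (snd x + fst x))"
    unfolding w_plus_def
  proof (rule sum.reindex_bij_witness[where i = "\<lambda>x. (snd x, snd x + fst x)" and j = "\<lambda>x. (snd x - fst x, fst x)"])
    fix x assume "x \<in> {(i, j). i < j \<and> p i j \<noteq> 0}"
    then obtain i j where x: "x = (i, j)" "i < j" "p i j \<noteq> 0" by blast
    with square_boxD[OF assms x(3)] show "(snd x - fst x, fst x) \<in> T" by (auto simp: T_def)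
  next
    fix x assume "x \<in> T"
    then show "(snd x, snd x + fst x) \<in> {(i, j). i < j \<and> p i j \<noteq> 0}"
      unfolding T_def by auto
  qed auto
  also have "\<dots> = (\<Sum>x\<in>{1..<L} \<times> {..<L}. p (snd x) (snd x + fst x))"
    by (rule sum.mono_neutral_left) (simp_all add: T_def)
  also have "\<dots> = (\<Sum>e=1..<L. \<Sum>l<L. p l (l + e))"
    unfolding sum.cartesian_product by (rule sum.cong) (simp_all add: split_beta)
  finally show ?thesis .
qed

lemma w_minus_transpose: "w_minus p = w_plus (\<lambda>i j. p j i)"
  unfolding w_plus_def w_minus_def
  by (rule sum.reindex_bij_witness[where i = prod.swap and j = prod.swap]) auto

lemma w_minus_box:
  assumes "p \<in> square_box L"
  shows "w_minus p = (\<Sum>e=1..<L. \<Sum>l<L. p (l + e) l)"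
  unfolding w_minus_transpose using assms by (subst w_plus_box[where L = L]) (auto simp: square_box_def)

lemma pp_size_box:
  assumes "p \<in> square_box L"
  shows "pp_size p = w_plus p + w_minus p + (\<Sum>l<L. p l l)"
proof -
  let ?S = "{(i, j). p i j \<noteq> 0}"
  have fin: "finite ?S" using finite_subset[OF box_finite_support[OF assms]] by auto
  have "pp_size p = (\<Sum>(i, j) \<in> {(i, j). i < j \<and> p i j \<noteq> 0} \<union> {(i, j). i > j \<and> p i j \<noteq> 0} \<union> {(i, j). i = j \<and> p i j \<noteq> 0}. p i j)"
    unfolding pp_size_def by (rule sum.cong) auto
  also have "\<dots> = w_plus p + w_minus p + (\<Sum>(i, j) \<in> {(i, j). i = j \<and> p i j \<noteq> 0}. p i j)"
  proof -
    have "finite {(i, j). i < j \<and> p i j \<noteq> 0}" "finite {(i, j). i > j \<and> p i j \<noteq> 0}" "finite {(i, j). i = j \<and> p i j \<noteq> 0}"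
      by (rule finite_subset[OF _ fin], blast)+
    then show ?thesis
      unfolding w_plus_def w_minus_def by (subst sum.union_disjoint, auto)+
  qed
  also have "(\<Sum>(i, j) \<in> {(i, j). i = j \<and> p i j \<noteq> 0}. p i j) = (\<Sum>l<L. p l l)"
    by (rule sum.reindex_bij_witness_not_neutral[where S' = "{}" and T' = "{l. l < L \<and> p l l = 0}" and
          i = "\<lambda>l. (l, l)" and j = fst]) (use square_boxD[OF assms] in auto)
  finally show ?thesis .
qed

text \<open>The value \<open>f b\<close> is counted once for every \<open>e\<close> with
  \<open>1 \<le> e < L - b\<close>, that is \<open>L - 1 - b\<close> times; reversing the index
  turns this multiplicity into the index itself.\<close>

lemma sum_initial_segments:
  fixes f :: "nat \<Rightarrow> nat"
  shows "(\<Sum>e=1..<L. \<Sum>b<L - e. f b) = (\<Sum>b<L. b * f (L - Suc b))"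
proof -
  have "(\<Sum>e=1..<L. \<Sum>b<L - e. f b) = (\<Sum>k=1..<L. \<Sum>b<k. f b)"
    by (rule sum.reindex_bij_witness[where i = "\<lambda>k. L - k" and j = "\<lambda>k. L - k"]) auto
  also have "\<dots> = (\<Sum>k<L. \<Sum>b<k. f b)"
    by (rule sum.mono_neutral_left) (auto simp: not_le)
  also have "\<dots> = (\<Sum>b<L. (L - Suc b) * f b)"
  proof (induction L)
    case (Suc L)
    have "(\<Sum>b<Suc L. (Suc L - Suc b) * f b) = (\<Sum>b<L. (L - Suc b) * f b + f b)"
      by simp (intro sum.cong refl, metis Suc_diff_Suc add.commute lessThan_iff mult_Suc)
    then show ?case using Suc by (simp add: sum.distrib)
  qed simp
  also have "\<dots> = (\<Sum>b<L. (L - Suc (L - Suc b)) * f (L - Suc b))"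
    by (rule sum.nat_diff_reindex[symmetric])
  also have "\<dots> = (\<Sum>b<L. b * f (L - Suc b))"
    by (intro sum.cong refl) auto
  finally show ?thesis .
qed

text \<open>By \<open>sum_growth\<close> the slice at distance \<open>e\<close> above the main
  diagonal has as its size the sum of the first \<open>L - e\<close> columns of \<open>G\<close>, so
  the weight of an entry depends only on its column.\<close>

lemma w_plus_pp_of_matrix:
  "w_plus (pp_of_matrix L G) = (\<Sum>a<L. \<Sum>b<L. b * G (L - Suc a) (L - Suc b))"
proof -
  have "w_plus (pp_of_matrix L G) = (\<Sum>e=1..<L. \<Sum>l<L. growth G L (L - e) l)"
    by (simp add: w_plus_box[OF pp_of_matrix_box] pp_of_matrix_def)
  also have "\<dots> = (\<Sum>a<L. \<Sum>e=1..<L. \<Sum>b<L - e. G a b)"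
    by (subst sum.swap) (simp add: sum_growth)
  also have "\<dots> = (\<Sum>a<L. \<Sum>b<L. b * G a (L - Suc b))"
    unfolding sum_initial_segments ..
  also have "\<dots> = (\<Sum>a<L. \<Sum>b<L. b * G (L - Suc a) (L - Suc b))"
    by (rule sum.nat_diff_reindex[symmetric])
  finally show ?thesis .
qed

lemma w_minus_pp_of_matrix:
  "w_minus (pp_of_matrix L G) = (\<Sum>a<L. \<Sum>b<L. a * G (L - Suc a) (L - Suc b))"
proof -
  have "w_minus (pp_of_matrix L G) = (\<Sum>e=1..<L. \<Sum>l<L. growth G (L - e) L l)"
    by (simp add: w_minus_box[OF pp_of_matrix_box] pp_of_matrix_def)
  also have "\<dots> = (\<Sum>e=1..<L. \<Sum>a<L - e. \<Sum>b<L. G a b)"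
    by (intro sum.cong refl sum_growth) auto
  also have "\<dots> = (\<Sum>a<L. \<Sum>b<L. a * G (L - Suc a) b)"
    unfolding sum_initial_segments sum_distrib_left ..
  also have "\<dots> = (\<Sum>a<L. \<Sum>b<L. a * G (L - Suc a) (L - Suc b))"
    by (intro sum.cong refl sum.nat_diff_reindex[symmetric])
  finally show ?thesis .
qed

lemma pp_size_pp_of_matrix:
  "pp_size (pp_of_matrix L G) = (\<Sum>a<L. \<Sum>b<L. (a + b + 1) * G (L - Suc a) (L - Suc b))"
proof -
  have "(\<Sum>l<L. pp_of_matrix L G l l) = (\<Sum>a<L. \<Sum>b<L. G a b)"
    by (simp add: pp_of_matrix_def sum_growth)
  also have "\<dots> = (\<Sum>a<L. \<Sum>b<L. G (L - Suc a) b)"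
    by (rule sum.nat_diff_reindex[symmetric])
  also have "\<dots> = (\<Sum>a<L. \<Sum>b<L. G (L - Suc a) (L - Suc b))"
    by (intro sum.cong refl sum.nat_diff_reindex[symmetric])
  finally show ?thesis
    unfolding pp_size_box[OF pp_of_matrix_box] w_plus_pp_of_matrix w_minus_pp_of_matrix
    by (simp add: sum.distrib algebra_simps)
qed

text \<open>A nonzero entry forces all entries before it in its row and in its column to be nonzero,
  and each of them contributes at least 1 to the size.\<close>

lemma plane_partitions_box: "plane_partitions n \<subseteq> square_box n"
proof
  fix p assume "p \<in> plane_partitions n"
  then have p: "plane_partition p" "pp_size p = n" by (auto simp: plane_partitions_def)
  let ?S = "{(i, j). p i j \<noteq> 0}"
  have fin: "finite ?S" and mono: "p (Suc i) j \<le> p i j" "p i (Suc j) \<le> p i j" for i j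
    using p by (auto simp: plane_partition_def)
  have m1: "p (i + d) j \<le> p i j" and m2: "p i (j + d) \<le> p i j" for i j d
    by (induction d) (auto intro: order.trans[OF mono(1)] order.trans[OF mono(2)])
  have "card A \<le> n" if "A \<subseteq> ?S" for A
  proof -
    have "card A = (\<Sum>x\<in>A. 1)" by simp
    also have "\<dots> \<le> (\<Sum>x\<in>A. case x of (i, j) \<Rightarrow> p i j)"
      using that by (intro sum_mono) auto
    also have "\<dots> \<le> (\<Sum>x\<in>?S. case x of (i, j) \<Rightarrow> p i j)"
      using that fin by (intro sum_mono2) auto
    finally show ?thesis using p(2) by (simp add: pp_size_def)
  qed note * = this
  have "a < n \<and> b < n" if "p a b \<noteq> 0" for a b
  proof
    have "p i b \<noteq> 0" if "i \<le> a" for i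
      using m1[of i "a - i" b] that \<open>p a b \<noteq> 0\<close> by simp
    then have "(\<lambda>i. (i, b)) ` {..a} \<subseteq> ?S" by auto
    from *[OF this] show "a < n" by (subst (asm) card_image) (auto simp: inj_on_def)
    have "p a j \<noteq> 0" if "j \<le> b" for j
      using m2[of a j "b - j"] that \<open>p a b \<noteq> 0\<close> by simp
    then have "Pair a ` {..b} \<subseteq> ?S" by auto
    from *[OF this] show "b < n" by (subst (asm) card_image) (auto simp: inj_on_def)
  qed
  then have "n \<le> a \<or> n \<le> b \<longrightarrow> p a b = 0" for a b by (metis not_le)
  then show "p \<in> square_box n" by (simp add: square_box_def)
qed

text \<open>These are the cells of weight \<open>a + b + 1\<close> at most \<open>n\<close>; a
  heavier cell must be empty in a family of total weight \<open>n\<close>.\<close>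

definition triangle :: "nat \<Rightarrow> (nat \<times> nat) set" where
  "triangle n = {(a, b). a + b < n}"

lemma triangle_subset: "triangle n \<subseteq> {..<n} \<times> {..<n}"
  by (auto simp: triangle_def)

lemma finite_triangle [simp]: "finite (triangle n)"
  by (rule finite_subset[OF triangle_subset]) auto

definition cell_counts :: "nat \<Rightarrow> (nat \<times> nat \<Rightarrow> nat) set" where
  "cell_counts n = {H \<in> triangle n \<rightarrow>\<^sub>E UNIV. (\<Sum>(a, b) \<in> triangle n. (a + b + 1) * H (a, b)) = n}"

text \<open>Indices are reversed because growth starts at the inner corner: the last entry of the
  matrix enters only the main diagonal slice and so has weight 1.\<close>

definition pp_of_counts :: "nat \<Rightarrow> (nat \<times> nat \<Rightarrow> nat) \<Rightarrow> nat \<Rightarrow> nat \<Rightarrow> nat" where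
  "pp_of_counts n H = pp_of_matrix n (\<lambda>a b.
     if a < n \<and> b < n \<and> (n - Suc a, n - Suc b) \<in> triangle n then H (n - Suc a, n - Suc b) else 0)"

lemma sum_square_triangle:
  fixes f :: "nat \<Rightarrow> nat \<Rightarrow> nat"
  shows "(\<Sum>a<n. \<Sum>b<n. f a b * (if n - Suc a < n \<and> n - Suc b < n \<and> (n - Suc (n - Suc a), n - Suc (n - Suc b)) \<in> triangle n
      then H (n - Suc (n - Suc a), n - Suc (n - Suc b)) else 0))
    = (\<Sum>(a, b)\<in>triangle n. f a b * H (a, b))"
proof -
  have "(\<Sum>a<n. \<Sum>b<n. f a b * (if n - Suc a < n \<and> n - Suc b < n \<and> (n - Suc (n - Suc a), n - Suc (n - Suc b)) \<in> triangle n
      then H (n - Suc (n - Suc a), n - Suc (n - Suc b)) else 0))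
     = (\<Sum>a<n. \<Sum>b<n. f a b * (if (a, b) \<in> triangle n then H (a, b) else 0))"
    by (intro sum.cong refl) auto
  also have "\<dots> = (\<Sum>(a, b)\<in>{..<n} \<times> {..<n}. f a b * (if (a, b) \<in> triangle n then H (a, b) else 0))"
    by (rule sum.cartesian_product)
  also have "\<dots> = (\<Sum>(a, b)\<in>triangle n. f a b * H (a, b))"
    by (rule sum.mono_neutral_cong_right) (use triangle_subset in auto)
  finally show ?thesis .
qed

lemma w_plus_pp_of_counts: "w_plus (pp_of_counts n H) = (\<Sum>(a, b) \<in> triangle n. b * H (a, b))"
  unfolding pp_of_counts_def w_plus_pp_of_matrix by (rule sum_square_triangle)

lemma w_minus_pp_of_counts: "w_minus (pp_of_counts n H) = (\<Sum>(a, b) \<in> triangle n. a * H (a, b))"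
  unfolding pp_of_counts_def w_minus_pp_of_matrix by (rule sum_square_triangle)

lemma pp_size_pp_of_counts: "pp_size (pp_of_counts n H) = (\<Sum>(a, b) \<in> triangle n. (a + b + 1) * H (a, b))"
  unfolding pp_of_counts_def pp_size_pp_of_matrix by (rule sum_square_triangle)

lemma bij_pp_of_counts: "bij_betw (pp_of_counts n) (cell_counts n) (plane_partitions n)"
  unfolding bij_betw_def
proof
  show "inj_on (pp_of_counts n) (cell_counts n)"
  proof (rule inj_onI)
    fix H K assume *: "H \<in> cell_counts n" "K \<in> cell_counts n" "pp_of_counts n H = pp_of_counts n K"
    have "H (a, b) = K (a, b)" for a b
    proof (cases "(a, b) \<in> triangle n")
      case True
      then show ?thesis
        using pp_of_matrix_inj[OF *(3)[unfolded pp_of_counts_def], of "n - Suc a" "n - Suc b"] triangle_subset[of n]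
        by auto
    next
      case False
      then show ?thesis using *(1,2) by (auto simp: cell_counts_def PiE_def extensional_def)
    qed
    then show "H = K" by auto
  qed
  show "pp_of_counts n ` cell_counts n = plane_partitions n"
  proof (intro equalityI subsetI)
    fix p assume "p \<in> pp_of_counts n ` cell_counts n"
    then show "p \<in> plane_partitions n"
      using pp_size_pp_of_counts pp_of_matrix_plane_partition
      by (auto simp: plane_partitions_def cell_counts_def) (simp add: pp_of_counts_def)
  next
    fix p assume p: "p \<in> plane_partitions n"
    then obtain G where G: "G \<in> square_box n" "pp_of_matrix n G = p"
      using pp_of_matrix_surj[of p n] plane_partitions_box[of n] unfolding plane_partitions_def by blast
    define H where "H = restrict (\<lambda>(a, b). G (n - Suc a) (n - Suc b)) (triangle n)"
    have sz: "(\<Sum>a<n. \<Sum>b<n. (a + b + 1) * G (n - Suc a) (n - Suc b)) = n"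
      using p G(2) pp_size_pp_of_matrix[of n G] by (simp add: plane_partitions_def)
    \<comment> \<open>Outside the triangle the weight exceeds the total \<open>n\<close>, so
      restricting \<open>G\<close> to the triangle loses nothing.\<close>
    have z: "G (n - Suc a) (n - Suc b) = 0" if "a < n" "b < n" "\<not> a + b < n" for a b
    proof -
      have "(a + b + 1) * G (n - Suc a) (n - Suc b) \<le> (\<Sum>b<n. (a + b + 1) * G (n - Suc a) (n - Suc b))"
        using that by (intro member_le_sum) auto
      also have "\<dots> \<le> (\<Sum>a<n. \<Sum>b<n. (a + b + 1) * G (n - Suc a) (n - Suc b))"
        using that by (intro member_le_sum) auto
      finally have "(a + b + 1) * G (n - Suc a) (n - Suc b) \<le> n" using sz by simp
      then show ?thesis using that by (cases "G (n - Suc a) (n - Suc b)") auto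
    qed
    have "(\<lambda>a b. if a < n \<and> b < n \<and> (n - Suc a, n - Suc b) \<in> triangle n then H (n - Suc a, n - Suc b) else 0) = G"
    proof (intro ext)
      fix a b
      show "(if a < n \<and> b < n \<and> (n - Suc a, n - Suc b) \<in> triangle n then H (n - Suc a, n - Suc b) else 0) = G a b"
      proof (cases "a < n \<and> b < n")
        case True
        then show ?thesis using z[of "n - Suc a" "n - Suc b"] by (auto simp: H_def triangle_def)
      next
        case False
        then show ?thesis using G(1) by (auto simp: square_box_def not_less)
      qed
    qed
    then have Hp: "pp_of_counts n H = p" using G by (simp add: pp_of_counts_def)
    moreover have "H \<in> triangle n \<rightarrow>\<^sub>E UNIV" by (simp add: H_def)
    then have "H \<in> cell_counts n"
      using pp_size_pp_of_counts[of n H, unfolded Hp, symmetric] p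
      unfolding cell_counts_def plane_partitions_def by (simp only: mem_Collect_eq)
    ultimately show "p \<in> pp_of_counts n ` cell_counts n" by blast
  qed
qed

lemma cell_counts_le:
  assumes "H \<in> cell_counts n" "(a, b) \<in> triangle n"
  shows "H (a, b) \<le> n"
proof -
  have "H (a, b) \<le> (a + b + 1) * H (a, b)" by simp
  also have "\<dots> \<le> (\<Sum>(a, b) \<in> triangle n. (a + b + 1) * H (a, b))"
    using member_le_sum[OF assms(2), of "\<lambda>(a, b). (a + b + 1) * H (a, b)"] by simp
  finally show ?thesis using assms(1) by (simp add: cell_counts_def)
qed

lemma finite_cell_counts: "finite (cell_counts n)"
proof (rule finite_subset)
  show "cell_counts n \<subseteq> triangle n \<rightarrow>\<^sub>E {..n}"
  proof
    fix H assume H: "H \<in> cell_counts n"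
    show "H \<in> triangle n \<rightarrow>\<^sub>E {..n}"
    proof (rule PiE_I)
      fix x assume "x \<in> triangle n"
      then show "H x \<in> {..n}" using cell_counts_le[OF H, of "fst x" "snd x"] by simp
    qed (use H in \<open>auto simp: cell_counts_def PiE_def extensional_def\<close>)
  qed
qed (auto intro: finite_PiE)

lemma finite_plane_partitions: "finite (plane_partitions n)"
  using bij_betw_finite[OF bij_pp_of_counts] finite_cell_counts by blast

lemma plane_partitions_nonempty: "plane_partitions n \<noteq> {}"
proof -
  define p :: "nat \<Rightarrow> nat \<Rightarrow> nat" where "p = (\<lambda>i j. if i = 0 \<and> j = 0 then n else 0)"
  have s: "{(i, j). p i j \<noteq> 0} \<subseteq> {(0, 0)}" by (auto simp: p_def split: if_splits)
  then have "plane_partition p"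
    unfolding plane_partition_def using finite_subset[OF s] by (simp add: p_def[THEN fun_cong, THEN fun_cong])
  moreover have "pp_size p = (\<Sum>(i, j)\<in>{(0, 0)}. p i j)"
    unfolding pp_size_def by (rule sum.mono_neutral_left) (use s in auto)
  ultimately have "p \<in> plane_partitions n" by (auto simp: plane_partitions_def p_def)
  then show ?thesis by blast
qed

lemma sum_plane_partitions:
  "(\<Sum>p\<in>plane_partitions n. h (w_plus p) (w_minus p)) =
   (\<Sum>H\<in>cell_counts n. h (\<Sum>(a, b) \<in> triangle n. b * H (a, b)) (\<Sum>(a, b) \<in> triangle n. a * H (a, b)))"
  using sum.reindex_bij_betw[OF bij_pp_of_counts, of "\<lambda>p. h (w_plus p) (w_minus p)" n]
  by (simp add: w_plus_pp_of_counts w_minus_pp_of_counts)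

subsection \<open>Fourier coefficients of the generating function\<close>

definition hook :: "nat \<times> nat \<Rightarrow> real" where
  "hook x = real (fst x) + real (snd x) + 1"

definition skew :: "nat \<times> nat \<Rightarrow> real" where
  "skew x = real (snd x) - real (fst x)"

lemma hook_pos [simp]: "0 < hook x" by (simp add: hook_def)

lemma abs_skew_le: "\<bar>skew x\<bar> \<le> hook x" by (simp add: hook_def skew_def abs_if)

definition cell_weight :: "real \<Rightarrow> real \<Rightarrow> real \<Rightarrow> nat \<times> nat \<Rightarrow> complex" where
  "cell_weight \<tau> \<theta> \<alpha> x = of_real (exp (- \<tau> * hook x)) * cis (\<alpha> * hook x + \<theta> * skew x)"

lemma norm_cell_weight: "norm (cell_weight \<tau> \<theta> \<alpha> x) = exp (- \<tau> * hook x)"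
  by (simp add: cell_weight_def norm_mult)

text \<open>Joint characteristic function of size and \<open>w_plus - w_minus\<close> when the cell counts are independent
  geometric variables, normalised to equal 1 at the origin.\<close>

definition boltzmann_cf :: "nat \<Rightarrow> real \<Rightarrow> real \<Rightarrow> real \<Rightarrow> complex" where
  "boltzmann_cf n \<tau> \<theta> \<alpha> =
     (\<Prod>x\<in>triangle n. of_real (1 - exp (- \<tau> * hook x)) / (1 - cell_weight \<tau> \<theta> \<alpha> x))"

text \<open>Deliberately unnormalised: at \<open>\<theta> = 0\<close> it is the number of plane
  partitions of size \<open>n\<close>, the denominator of the characteristic function.\<close>

definition counts_cf :: "nat \<Rightarrow> real \<Rightarrow> complex" where
  "counts_cf n \<theta> = (\<Sum>H\<in>cell_counts n. cis (\<theta> * (\<Sum>x\<in>triangle n. skew x * H x)))"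

lemma continuous_cell_weight [continuous_intros]: "continuous_on A (\<lambda>\<alpha>. cell_weight \<tau> \<theta> \<alpha> x)"
  unfolding cell_weight_def cis_conv_exp by (intro continuous_intros)

lemma borel_measurable_cell_weight [measurable]: "(\<lambda>\<alpha>. cell_weight \<tau> \<theta> \<alpha> x) \<in> borel_measurable borel"
  by (intro borel_measurable_continuous_onI continuous_intros)

lemma borel_measurable_boltzmann_cf [measurable]: "boltzmann_cf n \<tau> \<theta> \<in> borel_measurable borel"
  unfolding boltzmann_cf_def[abs_def] by measurable

lemma borel_measurable_cis_mult [measurable]: "(\<lambda>\<alpha>. cis (c * \<alpha>)) \<in> borel_measurable borel"
  unfolding cis_conv_exp by (intro borel_measurable_continuous_onI continuous_intros)

lemma cis_sum: "finite A \<Longrightarrow> cis (\<Sum>x\<in>A. f x) = (\<Prod>x\<in>A. cis (f x))"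
  by (induction A rule: finite_induct) (auto simp flip: cis_mult)

lemma integral_cis_int:
  fixes k :: int
  shows "(LINT \<alpha>:{-pi..pi}|lborel. cis (\<alpha> * of_int k)) = (if k = 0 then 2 * pi else 0)"
proof (cases "k = 0")
  case True
  then show ?thesis by (simp add: set_lebesgue_integral_def scaleR_conv_of_real)
next
  case False
  have "((\<lambda>\<alpha>. cis (\<alpha> * of_int k)) has_integral
       (cis (pi * of_int k) / (\<i> * of_int k) - cis (- pi * of_int k) / (\<i> * of_int k))) {-pi..pi}"
  proof (rule fundamental_theorem_of_calculus)
    fix x :: real
    show "((\<lambda>\<alpha>. cis (\<alpha> * of_int k) / (\<i> * of_int k)) has_vector_derivative cis (x * of_int k)) (at x within {-pi..pi})"
      unfolding cis_conv_exp
      by (rule derivative_eq_intros has_vector_derivative_real_field refl | simp add: False mult_ac)+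
  qed simp
  moreover have "cis (pi * of_int k) = cis (- pi * of_int k)"
  proof -
    have "cis (pi * of_int k) = cis (- pi * of_int k) * cis (2 * pi * of_int k)"
      by (simp add: cis_mult algebra_simps)
    also have "cis (2 * pi * of_int k) = 1" by (rule cis_multiple_2pi) auto
    finally show ?thesis by simp
  qed
  ultimately have "((\<lambda>\<alpha>. cis (\<alpha> * of_int k)) has_integral 0) {-pi..pi}" by simp
  moreover have si: "set_integrable lborel {-pi..pi} (\<lambda>\<alpha>. cis (\<alpha> * of_int k))"
    unfolding cis_conv_exp by (intro borel_integrable_atLeastAtMost' continuous_intros)
  ultimately show ?thesis
    using False set_borel_integral_eq_integral(2)[OF si] by (simp add: integral_unique)
qed

text \<open>Expanding each factor as a geometric series and integrating against the Fourier kernel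
  keeps exactly the families of total weight \<open>n\<close>. On these the damping is the constant
  \<open>exp (- \<tau> * n)\<close>, so the identity holds for every positive
  \<open>\<tau>\<close>.\<close>

lemma counts_cf_integral:
  assumes "\<tau> > 0"
  shows "(LINT \<alpha>:{-pi..pi}|lborel. boltzmann_cf n \<tau> \<theta> \<alpha> * cis (- real n * \<alpha>)) =
     2 * pi * (\<Prod>x\<in>triangle n. 1 - exp (- \<tau> * hook x)) * exp (- \<tau> * real n) * counts_cf n \<theta>"
proof -
  let ?T = "triangle n" and ?w = "cell_weight \<tau> \<theta>"
  define Z where "Z = (\<Prod>x\<in>triangle n. 1 - exp (- \<tau> * hook x))"
  define N where "N H = (\<Sum>x\<in>?T. (fst x + snd x + 1) * H x)" for H :: "nat \<times> nat \<Rightarrow> nat"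
  define D where "D H = (\<Sum>x\<in>?T. skew x * H x)" for H :: "nat \<times> nat \<Rightarrow> nat"
  \<comment> \<open>With the series truncated at \<open>K\<close> the integrand is a finite
    trigonometric sum. Counts in a family of weight \<open>n\<close> are at most \<open>n\<close>,
    so its integral is already the final value as soon as \<open>K > n\<close>.\<close>
  define P where "P K \<alpha> = of_real Z * (\<Prod>x\<in>?T. \<Sum>g<K. ?w \<alpha> x ^ g) * cis (- real n * \<alpha>)" for K :: nat and \<alpha>
  have P_eq: "P K \<alpha> = (\<Sum>H\<in>?T \<rightarrow>\<^sub>E {..<K}. of_real (Z * exp (- \<tau> * N H)) * cis (\<theta> * D H) * cis (\<alpha> * of_int (int (N H) - int n)))" for K \<alpha>
  proof -
    have "(\<Prod>x\<in>?T. ?w \<alpha> x ^ H x) = of_real (exp (- \<tau> * N H)) * cis (\<theta> * D H) * cis (\<alpha> * N H)" for H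
    proof -
      have "(\<Prod>x\<in>?T. ?w \<alpha> x ^ H x) = (\<Prod>x\<in>?T. of_real (exp (- \<tau> * hook x * H x)) * cis (\<theta> * (skew x * H x) + \<alpha> * (hook x * H x)))"
        unfolding cell_weight_def
        by (intro prod.cong refl) (simp add: power_mult_distrib Complex.DeMoivre exp_of_nat_mult[symmetric] algebra_simps flip: of_real_power)
      also have "\<dots> = of_real (exp (\<Sum>x\<in>?T. - \<tau> * hook x * H x)) * cis (\<Sum>x\<in>?T. \<theta> * (skew x * H x) + \<alpha> * (hook x * H x))"
        by (simp only: prod.distrib of_real_prod[symmetric] exp_sum[OF finite_triangle] cis_sum[OF finite_triangle])
      also have "(\<Sum>x\<in>?T. - \<tau> * hook x * H x) = - \<tau> * N H"
        by (simp add: N_def hook_def sum_distrib_left algebra_simps)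
      also have "(\<Sum>x\<in>?T. \<theta> * (skew x * H x) + \<alpha> * (hook x * H x)) = \<theta> * D H + \<alpha> * N H"
        by (simp add: N_def D_def hook_def sum_distrib_left sum.distrib algebra_simps)
      finally show ?thesis by (simp add: cis_mult)
    qed
    then have "P K \<alpha> = (\<Sum>H\<in>?T \<rightarrow>\<^sub>E {..<K}. of_real Z * (of_real (exp (- \<tau> * N H)) * cis (\<theta> * D H) * cis (\<alpha> * N H)) * cis (- real n * \<alpha>))"
      unfolding P_def by (simp add: prod_sum_PiE sum_distrib_left sum_distrib_right)
    also have "\<dots> = (\<Sum>H\<in>?T \<rightarrow>\<^sub>E {..<K}. of_real (Z * exp (- \<tau> * N H)) * cis (\<theta> * D H) * cis (\<alpha> * of_int (int (N H) - int n)))"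
      by (intro sum.cong refl) (simp add: cis_mult algebra_simps)
    finally show ?thesis .
  qed
  have int_P: "(LINT \<alpha>:{-pi..pi}|lborel. P K \<alpha>) = 2 * pi * Z * exp (- \<tau> * real n) * counts_cf n \<theta>" if "K > n" for K
  proof -
    have "(LINT \<alpha>:{-pi..pi}|lborel. P K \<alpha>) = (\<Sum>H\<in>?T \<rightarrow>\<^sub>E {..<K}. LINT \<alpha>:{-pi..pi}|lborel. of_real (Z * exp (- \<tau> * N H)) * cis (\<theta> * D H) * cis (\<alpha> * of_int (int (N H) - int n)))"
      unfolding P_eq set_lebesgue_integral_def scaleR_sum_right
      by (intro Bochner_Integration.integral_sum, fold set_integrable_def, unfold cis_conv_exp, intro borel_integrable_atLeastAtMost' continuous_intros)
    also have "\<dots> = (\<Sum>H\<in>?T \<rightarrow>\<^sub>E {..<K}. of_real (Z * exp (- \<tau> * N H)) * cis (\<theta> * D H) * (if N H = n then 2 * pi else 0))"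
      by (simp only: set_integral_mult_right integral_cis_int) simp
    also have "\<dots> = (\<Sum>H\<in>{H\<in>?T \<rightarrow>\<^sub>E {..<K}. N H = n}. of_real (Z * exp (- \<tau> * N H)) * cis (\<theta> * D H) * (2 * pi))"
      by (rule sum.mono_neutral_cong_right) (auto intro: finite_PiE)
    also have "{H\<in>?T \<rightarrow>\<^sub>E {..<K}. N H = n} = cell_counts n"
    proof -
      have N': "N H = (\<Sum>(a, b) \<in> triangle n. (a + b + 1) * H (a, b))" for H
        by (simp add: N_def split_beta)
      have "H \<in> ?T \<rightarrow>\<^sub>E {..<K}" if "H \<in> cell_counts n" for H
      proof (rule PiE_I)
        fix x assume "x \<in> ?T"
        then show "H x \<in> {..<K}" using cell_counts_le[OF that, of "fst x" "snd x"] \<open>n < K\<close> by simp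
      qed (use that in \<open>auto simp: cell_counts_def PiE_def extensional_def\<close>)
      then show ?thesis unfolding N' by (auto simp: cell_counts_def PiE_def)
    qed
    also have "(\<Sum>H\<in>cell_counts n. of_real (Z * exp (- \<tau> * N H)) * cis (\<theta> * D H) * (2 * pi))
       = (\<Sum>H\<in>cell_counts n. of_real (Z * exp (- \<tau> * n)) * cis (\<theta> * D H) * (2 * pi))"
      by (intro sum.cong refl) (auto simp: cell_counts_def N_def split_beta)
    also have "\<dots> = 2 * pi * Z * exp (- \<tau> * real n) * counts_cf n \<theta>"
      unfolding counts_cf_def D_def by (simp add: sum_distrib_left algebra_simps)
    finally show ?thesis .
  qed
  have q: "0 < exp (- \<tau> * hook x)" "exp (- \<tau> * hook x) < 1" for x
    using assms hook_pos[of x] by (simp_all del: hook_pos)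
  have "(\<lambda>K. LINT \<alpha>:{-pi..pi}|lborel. P K \<alpha>) \<longlonglongrightarrow> (LINT \<alpha>:{-pi..pi}|lborel. boltzmann_cf n \<tau> \<theta> \<alpha> * cis (- real n * \<alpha>))"
    unfolding set_lebesgue_integral_def
  proof (rule integral_dominated_convergence[where w = "\<lambda>\<alpha>. indicator {-pi..pi} \<alpha>"])
    show "(\<lambda>\<alpha>. indicator {-pi..pi} \<alpha> *\<^sub>R (boltzmann_cf n \<tau> \<theta> \<alpha> * cis (- real n * \<alpha>))) \<in> borel_measurable lborel" by measurable
    show "(\<lambda>\<alpha>. indicator {-pi..pi} \<alpha> *\<^sub>R P K \<alpha>) \<in> borel_measurable lborel" for K
      unfolding P_def by measurable
    show "integrable lborel (indicat_real {- pi..pi})" by simp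
    have "(\<lambda>K. P K \<alpha>) \<longlonglongrightarrow> boltzmann_cf n \<tau> \<theta> \<alpha> * cis (- real n * \<alpha>)" for \<alpha>
    proof -
      have "(\<lambda>K. \<Sum>g<K. ?w \<alpha> x ^ g) \<longlonglongrightarrow> 1 / (1 - ?w \<alpha> x)" for x
        using geometric_sums[of "?w \<alpha> x"] q[of x] unfolding sums_def norm_cell_weight by simp
      then have "(\<lambda>K. P K \<alpha>) \<longlonglongrightarrow> of_real Z * (\<Prod>x\<in>?T. 1 / (1 - ?w \<alpha> x)) * cis (- real n * \<alpha>)"
        unfolding P_def by (intro tendsto_intros)
      then show ?thesis by (simp add: boltzmann_cf_def Z_def prod_dividef)
    qed
    then show "AE \<alpha> in lborel. (\<lambda>K. indicat_real {- pi..pi} \<alpha> *\<^sub>R P K \<alpha>) \<longlonglongrightarrow>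
            indicat_real {- pi..pi} \<alpha> *\<^sub>R (boltzmann_cf n \<tau> \<theta> \<alpha> * cis (- real n * \<alpha>))"
      by (intro always_eventually allI tendsto_intros)
    \<comment> \<open>\<open>Z\<close> is the reciprocal of the product of the full geometric sums
      of the moduli, so the normalised truncations have a constant majorant.\<close>
    have "norm (P K \<alpha>) \<le> 1" for K \<alpha>
    proof -
      have "norm (\<Sum>g<K. ?w \<alpha> x ^ g) \<le> 1 / (1 - exp (- \<tau> * hook x))" for x
      proof -
        have "norm (\<Sum>g<K. ?w \<alpha> x ^ g) \<le> (\<Sum>g<K. exp (- \<tau> * hook x) ^ g)"
          by (rule order.trans[OF norm_sum]) (simp add: norm_power norm_cell_weight)
        also have "\<dots> \<le> (\<Sum>g. exp (- \<tau> * hook x) ^ g)"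
          using q[of x] by (intro sum_le_suminf summable_geometric) auto
        also have "\<dots> = 1 / (1 - exp (- \<tau> * hook x))"
          using q[of x] by (intro suminf_geometric) auto
        finally show ?thesis .
      qed
      then have "norm (\<Prod>x\<in>?T. \<Sum>g<K. ?w \<alpha> x ^ g) \<le> (\<Prod>x\<in>?T. 1 / (1 - exp (- \<tau> * hook x)))"
        by (subst prod_norm[symmetric]) (intro prod_mono, auto)
      also have "\<dots> = 1 / Z" by (simp add: Z_def prod_dividef)
      finally have "norm (\<Prod>x\<in>?T. \<Sum>g<K. ?w \<alpha> x ^ g) \<le> 1 / Z" .
      moreover have "Z > 0" using q unfolding Z_def by (intro prod_pos) simp
      ultimately show ?thesis by (simp add: P_def norm_mult field_simps)
    qed
    then show "AE \<alpha> in lborel. norm (indicat_real {- pi..pi} \<alpha> *\<^sub>R P K \<alpha>) \<le> indicat_real {- pi..pi} \<alpha>" for K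
      by (auto simp: indicator_def)
  qed
  moreover have "(\<lambda>K. LINT \<alpha>:{-pi..pi}|lborel. P K \<alpha>) \<longlonglongrightarrow> 2 * pi * Z * exp (- \<tau> * real n) * counts_cf n \<theta>"
    by (rule tendsto_eventually) (use int_P in \<open>auto simp: eventually_at_top_dense intro!: exI[of _ n]\<close>)
  ultimately show ?thesis unfolding Z_def by (rule LIMSEQ_unique)
qed

lemma counts_cf_plane_partitions:
  "(\<Sum>p\<in>plane_partitions n. cis (\<theta> * (real (w_plus p) - real (w_minus p)))) = counts_cf n \<theta>"
  unfolding sum_plane_partitions[of "\<lambda>u v. cis (\<theta> * (real u - real v))"] counts_cf_def
  by (intro sum.cong refl arg_cong[of _ _ cis] arg_cong2[of _ _ _ _ "(*)"])
     (simp add: skew_def split_beta sum_subtractf algebra_simps)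

lemma char_pp_diff_law:
  assumes "n > 0"
  shows "char (pp_diff_law n) t = counts_cf n (t / real n powr (2/3)) / counts_cf n 0"
proof -
  let ?M = "measure_pmf (pmf_of_set (plane_partitions n))" and ?\<theta> = "t / real n powr (2/3)"
  have "char (pp_diff_law n) t = (LINT p|?M. cis (?\<theta> * (real (w_plus p) - real (w_minus p))))"
  proof -
    have "(\<lambda>x. iexp (t * x)) \<in> borel_measurable borel"
      by (intro borel_measurable_continuous_onI continuous_intros)
    then have "char (pp_diff_law n) t = (LINT p|?M. iexp (t * (real (w_plus p) / real n powr (2/3) - real (w_minus p) / real n powr (2/3))))"
      unfolding char_def pp_diff_law_def by (subst integral_distr) simp_all
    moreover have "t * (real (w_plus p) / real n powr (2/3) - real (w_minus p) / real n powr (2/3)) = ?\<theta> * (real (w_plus p) - real (w_minus p))" for p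
      by (simp add: diff_divide_distrib right_diff_distrib)
    ultimately show ?thesis by (simp only: cis_conv_exp)
  qed
  also have "\<dots> = (\<Sum>p\<in>plane_partitions n. cis (?\<theta> * (real (w_plus p) - real (w_minus p)))) / card (plane_partitions n)"
  proof -
    have "pmf (pmf_of_set (plane_partitions n)) p = 1 / card (plane_partitions n)" if "p \<in> plane_partitions n" for p
      using that finite_plane_partitions plane_partitions_nonempty by (simp add: pmf_of_set)
    moreover have "set_pmf (pmf_of_set (plane_partitions n)) = plane_partitions n"
      using finite_plane_partitions plane_partitions_nonempty by simp
    ultimately show ?thesis
      unfolding sum_divide_distrib
      by (subst integral_measure_pmf[OF finite_plane_partitions])
         (auto intro!: sum.cong simp: scaleR_conv_of_real)
  qed
  also have "of_nat (card (plane_partitions n)) = (\<Sum>p\<in>plane_partitions n. cis (0 * (real (w_plus p) - real (w_minus p))))"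
    by simp
  finally show ?thesis unfolding counts_cf_plane_partitions .
qed

subsection \<open>Riemann sums and Bose integrals\<close>

text \<open>The Bose-Einstein function: the mean of a geometric variable with ratio
  \<open>exp (- x)\<close>. Its variance is \<open>bose x + (bose x)\<^sup>2\<close>.\<close>

definition bose :: "real \<Rightarrow> real" where
  "bose x = 1 / (exp x - 1)"

lemma bose_pos: "0 < x \<Longrightarrow> 0 < bose x"
  by (simp add: bose_def)

text \<open>The first bound combines the pole at 0 with exponential decay; it comes from factoring
  \<open>exp x - 1\<close> as \<open>(exp (x / 2) - 1) * (exp (x / 2) + 1)\<close>.\<close>

lemma bose_le:
  assumes "0 < x"
  shows "bose x \<le> 2 * exp (- x / 2) / x" "bose x \<le> 1 / x"
proof -
  have "exp x - 1 \<ge> x" using exp_ge_add_one_self[of x] by linarith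
  then show "bose x \<le> 1 / x" using assms by (simp add: bose_def frac_le)
  have h: "x / 2 \<le> exp (x / 2) - 1" using exp_ge_add_one_self[of "x / 2"] by linarith
  have "x / 2 * exp (x / 2) \<le> (exp (x / 2) - 1) * (exp (x / 2) + 1)"
    by (intro mult_mono h) (use assms in auto)
  also have "\<dots> = exp x - 1"
    by (simp add: algebra_simps flip: exp_add)
  finally have "bose x \<le> 1 / (x / 2 * exp (x / 2))"
    unfolding bose_def using assms by (intro frac_le) auto
  then show "bose x \<le> 2 * exp (- x / 2) / x"
    using assms by (simp add: exp_minus field_simps)
qed

lemma bose_antimono: "0 < x \<Longrightarrow> x \<le> y \<Longrightarrow> bose y \<le> bose x"
  unfolding bose_def by (intro frac_le) auto

lemma continuous_on_bose [continuous_intros]: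
  assumes "continuous_on A f" "\<And>x. x \<in> A \<Longrightarrow> 0 < f x"
  shows "continuous_on A (\<lambda>x. bose (f x))"
proof -
  have "exp (f x) - 1 \<noteq> 0" if "x \<in> A" for x using assms(2)[OF that] by simp
  then show ?thesis unfolding bose_def by (intro continuous_intros assms ballI)
qed

text \<open>Half of the decay pays for the power: \<open>(x / 4) ^ k / fact k\<close> is a single
  term of the series of \<open>exp (x / 4)\<close>.\<close>

lemma power_mult_exp_le:
  fixes x :: real
  assumes "0 \<le> x"
  shows "x ^ k * exp (- x / 2) \<le> 4 ^ k * fact k * exp (- x / 4)"
proof -
  have "(x / 4) ^ k / fact k \<le> exp (x / 4)"
  proof -
    have s: "(\<lambda>n. (x / 4) ^ n /\<^sub>R fact n) sums exp (x / 4)" by (rule exp_converges)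
    have "(\<Sum>n\<in>{k}. (x / 4) ^ n /\<^sub>R fact n) \<le> (\<Sum>n. (x / 4) ^ n /\<^sub>R fact n)"
      by (rule sum_le_suminf[OF sums_summable[OF s]]) (use assms in auto)
    also have "\<dots> = exp (x / 4)" by (rule sums_unique[OF s, symmetric])
    finally have "(x / 4) ^ k /\<^sub>R fact k \<le> exp (x / 4)" by simp
    then show ?thesis by (simp only: real_scaleR_def divide_inverse mult.commute)
  qed
  then have "x ^ k / 4 ^ k \<le> fact k * exp (x / 4)"
    by (simp add: power_divide pos_divide_le_eq mult_ac)
  then have "x ^ k \<le> 4 ^ k * fact k * exp (x / 4)"
    by (simp only: pos_divide_le_eq zero_less_power zero_less_numeral mult_ac)
  then have "x ^ k * exp (- x / 2) \<le> 4 ^ k * fact k * exp (x / 4) * exp (- x / 2)"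
    by (intro mult_right_mono) auto
  also have "\<dots> = 4 ^ k * fact k * exp (- x / 4)"
    by (simp add: mult.assoc flip: exp_add)
  finally show ?thesis .
qed

text \<open>The sum is the integral of a step function, to which dominated convergence applies.
  Sampling at right endpoints avoids the point 0, where \<open>g\<close> need not be defined
  sensibly, and lets the decreasing majorant at the sample be replaced by its value at
  \<open>x\<close>. The third assumption on \<open>\<tau>\<close> makes the steps exhaust the
  half-line.\<close>

lemma riemann_sum_limit:
  fixes g :: "real \<Rightarrow> real" and \<tau> :: "nat \<Rightarrow> real"
  assumes \<tau>: "\<And>n. \<tau> n > 0" "\<tau> \<longlonglongrightarrow> 0" "filterlim (\<lambda>n. real n * \<tau> n) at_top sequentially"
    and g: "continuous_on {0<..} g" "\<And>x. 0 < x \<Longrightarrow> \<bar>g x\<bar> \<le> C * exp (- x / 4)"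
  shows "(\<lambda>n. \<tau> n * (\<Sum>m=1..n. g (\<tau> n * real m))) \<longlonglongrightarrow> (LINT x:{0<..}|lborel. g x)"
proof -
  define s where "s n x = (\<Sum>m=1..n. indicator {\<tau> n * (real m - 1) <.. \<tau> n * real m} x * g (\<tau> n * real m))" for n x
  have s_eq: "s n x = indicator {0<..\<tau> n * real n} x * g (\<tau> n * of_int \<lceil>x / \<tau> n\<rceil>)" for n x
  proof -
    define k where "k = nat \<lceil>x / \<tau> n\<rceil>"
    have ind: "indicator {\<tau> n * (real m - 1) <.. \<tau> n * real m} x = (if m = k then 1 else (0::real))" if "m \<ge> 1" for m
    proof -
      have "x \<in> {\<tau> n * (real m - 1) <.. \<tau> n * real m} \<longleftrightarrow> real m - 1 < x / \<tau> n \<and> x / \<tau> n \<le> real m"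
        using \<tau>(1)[of n] by (simp add: field_simps)
      also have "\<dots> \<longleftrightarrow> \<lceil>x / \<tau> n\<rceil> = int m"
        by (auto simp: ceiling_eq_iff)
      also have "\<dots> \<longleftrightarrow> m = k" using that by (auto simp: k_def)
      finally show ?thesis by (simp add: indicator_def)
    qed
    have "s n x = (\<Sum>m=1..n. if m = k then g (\<tau> n * real m) else 0)"
      unfolding s_def by (intro sum.cong refl) (simp add: ind)
    also have "\<dots> = (if k \<in> {1..n} then g (\<tau> n * real k) else 0)"
      by (simp add: sum.delta)
    also have "k \<in> {1..n} \<longleftrightarrow> x \<in> {0<..\<tau> n * real n}"
    proof -
      have "nat c \<in> {1..n} \<longleftrightarrow> 0 < c \<and> c \<le> int n" for c by auto
      then have "k \<in> {1..n} \<longleftrightarrow> 0 < \<lceil>x / \<tau> n\<rceil> \<and> \<lceil>x / \<tau> n\<rceil> \<le> int n"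
        unfolding k_def .
      also have "\<dots> \<longleftrightarrow> 0 < x / \<tau> n \<and> x / \<tau> n \<le> real n"
        by (simp add: ceiling_le_iff)
      also have "\<dots> \<longleftrightarrow> x \<in> {0<..\<tau> n * real n}"
        using \<tau>(1)[of n] by (simp add: field_simps)
      finally show ?thesis .
    qed
    also have "(if x \<in> {0<..\<tau> n * real n} then g (\<tau> n * real k) else 0) = indicator {0<..\<tau> n * real n} x * g (\<tau> n * of_int \<lceil>x / \<tau> n\<rceil>)"
    proof -
      have "real k = of_int \<lceil>x / \<tau> n\<rceil>" if "x \<in> {0<..\<tau> n * real n}"
      proof -
        have "0 < x / \<tau> n" using that \<tau>(1)[of n] by simp
        then show ?thesis by (simp add: k_def)
      qed
      then show ?thesis by (simp add: indicator_def)
    qed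
    finally show ?thesis .
  qed
  have meas_g: "(\<lambda>x. indicator {0<..} x *\<^sub>R g x) \<in> borel_measurable borel"
    using g(1) by (intro borel_measurable_continuous_on_indicator) auto
  have "(\<lambda>n. LINT x|lborel. s n x) \<longlonglongrightarrow> (LINT x|lborel. indicator {0<..} x *\<^sub>R g x)"
  proof (rule integral_dominated_convergence[where w = "\<lambda>x. indicator {0..} x * (C * exp (- x / 4))"])
    show "(\<lambda>x. indicator {0<..} x *\<^sub>R g x) \<in> borel_measurable lborel" using meas_g by simp
    show "s n \<in> borel_measurable lborel" for n unfolding s_def[abs_def] by measurable
    have "integrable lborel (\<lambda>x. erlang_density 0 (1/4) x)"
      using nn_integral_erlang_ith_moment[of "1/4" 0 0] by (intro integrableI_nonneg) auto
    then have "integrable lborel (\<lambda>x. 4 * C * erlang_density 0 (1/4) x)" by simp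
    also have "(\<lambda>x. 4 * C * erlang_density 0 (1/4) x) = (\<lambda>x. indicator {0..} x * (C * exp (- x / 4)))"
      by (auto simp: erlang_density_def indicator_def)
    finally show "integrable lborel (\<lambda>x. indicator {0..} x * (C * exp (- x / 4)))" .
    show "AE x in lborel. (\<lambda>n. s n x) \<longlonglongrightarrow> indicator {0<..} x *\<^sub>R g x"
    proof (intro always_eventually allI)
      fix x :: real
      show "(\<lambda>n. s n x) \<longlonglongrightarrow> indicator {0<..} x *\<^sub>R g x"
      proof (cases "x > 0")
        case True
        have "\<forall>\<^sub>F n in sequentially. x \<le> real n * \<tau> n"
          using \<tau>(3) by (simp add: filterlim_at_top)
        then have ev: "\<forall>\<^sub>F n in sequentially. g (\<tau> n * of_int \<lceil>x / \<tau> n\<rceil>) = s n x"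
          by eventually_elim (use True in \<open>simp add: s_eq mult.commute\<close>)
        have "(\<lambda>n. \<tau> n * of_int \<lceil>x / \<tau> n\<rceil>) \<longlonglongrightarrow> x"
        proof (rule tendsto_sandwich)
          have b: "x \<le> \<tau> n * of_int \<lceil>x / \<tau> n\<rceil> \<and> \<tau> n * of_int \<lceil>x / \<tau> n\<rceil> \<le> x + \<tau> n" for n
          proof -
            have "x / \<tau> n \<le> of_int \<lceil>x / \<tau> n\<rceil>" "of_int \<lceil>x / \<tau> n\<rceil> \<le> x / \<tau> n + 1" by linarith+
            then have "\<tau> n * (x / \<tau> n) \<le> \<tau> n * of_int \<lceil>x / \<tau> n\<rceil>" "\<tau> n * of_int \<lceil>x / \<tau> n\<rceil> \<le> \<tau> n * (x / \<tau> n + 1)"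
              using \<tau>(1)[of n] by (intro mult_left_mono; simp)+
            then show ?thesis using \<tau>(1)[of n] by (simp add: distrib_left)
          qed
          show "\<forall>\<^sub>F n in sequentially. x \<le> \<tau> n * of_int \<lceil>x / \<tau> n\<rceil>" "\<forall>\<^sub>F n in sequentially. \<tau> n * of_int \<lceil>x / \<tau> n\<rceil> \<le> x + \<tau> n"
            using b by auto
          show "(\<lambda>n. x + \<tau> n) \<longlonglongrightarrow> x" using tendsto_add[OF tendsto_const \<tau>(2), of x] by simp
        qed simp
        moreover have "isCont g x"
          using g(1) True by (simp add: continuous_on_eq_continuous_at)
        ultimately have "(\<lambda>n. g (\<tau> n * of_int \<lceil>x / \<tau> n\<rceil>)) \<longlonglongrightarrow> g x"
          by (rule isCont_tendsto_compose[rotated])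
        then show ?thesis using Lim_transform_eventually[OF _ ev] True by simp
      qed (auto simp: s_eq)
    qed
    show "AE x in lborel. norm (s n x) \<le> indicator {0..} x * (C * exp (- x / 4))" for n
    proof (intro always_eventually allI)
      fix x :: real
      have C: "C \<ge> 0" using g(2)[of 1] by (smt (verit) exp_gt_zero mult_neg_pos zero_less_one)
      show "norm (s n x) \<le> indicator {0..} x * (C * exp (- x / 4))"
      proof (cases "x \<in> {0<..\<tau> n * real n}")
        case True
        have "x / \<tau> n \<le> of_int \<lceil>x / \<tau> n\<rceil>" by linarith
        then have "\<tau> n * (x / \<tau> n) \<le> \<tau> n * of_int \<lceil>x / \<tau> n\<rceil>"
          using \<tau>(1)[of n] by (intro mult_left_mono) auto
        then have x: "x \<le> \<tau> n * of_int \<lceil>x / \<tau> n\<rceil>" using \<tau>(1)[of n] by simp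
        then have "\<bar>g (\<tau> n * of_int \<lceil>x / \<tau> n\<rceil>)\<bar> \<le> C * exp (- (\<tau> n * of_int \<lceil>x / \<tau> n\<rceil>) / 4)"
          using True by (intro g(2)) auto
        also have "\<dots> \<le> C * exp (- x / 4)" using x C by (intro mult_left_mono) auto
        finally show ?thesis using True by (simp add: s_eq)
      qed (use C in \<open>auto simp: s_eq indicator_def\<close>)
    qed
  qed
  moreover have "(LINT x|lborel. s n x) = \<tau> n * (\<Sum>m=1..n. g (\<tau> n * real m))" for n
  proof -
    have le: "\<tau> n * (real m - 1) \<le> \<tau> n * real m" for m using \<tau>(1)[of n] by simp
    have "(LINT x|lborel. s n x) = (\<Sum>m=1..n. LINT x|lborel. indicator {\<tau> n * (real m - 1) <.. \<tau> n * real m} x * g (\<tau> n * real m))"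
      unfolding s_def
      by (intro Bochner_Integration.integral_sum integrable_mult_left)
         (simp add: integrable_indicator_iff emeasure_lborel_Ioc[OF le])
    also have "\<dots> = (\<Sum>m=1..n. \<tau> n * g (\<tau> n * real m))"
      by (intro sum.cong refl) (simp add: measure_lborel_Ioc[OF le], simp add: algebra_simps)
    finally show ?thesis by (simp add: sum_distrib_left)
  qed
  ultimately show ?thesis by (simp add: set_lebesgue_integral_def)
qed

section \<open>Bose integrals as values of the zeta function\<close>

lemma has_bochner_integral_power_exp:
  fixes l :: real
  assumes "0 < l"
  shows "has_bochner_integral lborel (\<lambda>x. indicator {0<..} x * (x ^ k * exp (- l * x))) (fact k / l ^ Suc k)"
proof -
  have "has_bochner_integral lborel (erlang_density k l) 1"
    using nn_integral_erlang_ith_moment[OF assms, of k 0] assms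
    by (intro has_bochner_integral_nn_integral) auto
  then have "has_bochner_integral lborel (\<lambda>x. fact k / l ^ Suc k * erlang_density k l x) (fact k / l ^ Suc k * 1)"
    by (intro has_bochner_integral_mult_right)
  moreover have "AE x in lborel. fact k / l ^ Suc k * erlang_density k l x = indicator {0<..} x * (x ^ k * exp (- l * x))"
    using AE_lborel_singleton[of "0::real"]
    by eventually_elim (use assms in \<open>auto simp: erlang_density_def indicator_def\<close>)
  ultimately show ?thesis
    by (subst (asm) has_bochner_integral_cong_AE) auto
qed

lemma integral_exp_series:
  fixes c :: "nat \<Rightarrow> real" and f :: "real \<Rightarrow> real"
  assumes c: "\<And>r. 0 \<le> c r"
    and f: "\<And>x. 0 < x \<Longrightarrow> (\<lambda>r. c r * exp (- real (Suc r) * x)) sums f x"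
    and summable: "summable (\<lambda>r. c r * (fact k / real (Suc r) ^ Suc k))"
  shows "(LINT x:{0<..}|lborel. x ^ k * f x) = (\<Sum>r. c r * (fact k / real (Suc r) ^ Suc k))"
proof -
  define F where "F r x = c r * (indicator {0<..} x * (x ^ k * exp (- real (Suc r) * x)))" for r and x :: real
  have hb: "has_bochner_integral lborel (F r) (c r * (fact k / real (Suc r) ^ Suc k))" for r
    unfolding F_def by (intro has_bochner_integral_mult_right has_bochner_integral_power_exp) auto
  have F_sums: "(\<lambda>r. F r x) sums (indicator {0<..} x *\<^sub>R (x ^ k * f x))" for x
  proof (cases "x > 0")
    case True
    have "(\<lambda>r. x ^ k * (c r * exp (- real (Suc r) * x))) sums (x ^ k * f x)"
      by (intro sums_mult f True)
    then show ?thesis using True by (simp add: F_def mult_ac)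
  qed (simp add: F_def)
  have F_nonneg: "0 \<le> F r x" for r x
    using c by (auto simp: F_def indicator_def)
  have "(\<lambda>r. integral\<^sup>L lborel (F r)) sums (LINT x|lborel. (\<Sum>r. F r x))"
  proof (rule sums_integral)
    show "integrable lborel (F r)" for r using hb has_bochner_integral_iff by blast
    show "AE x in lborel. summable (\<lambda>i. norm (F i x))"
      using F_sums F_nonneg by (auto simp: sums_iff)
    show "summable (\<lambda>i. LINT x|lborel. norm (F i x))"
      using summable hb F_nonneg by (simp add: has_bochner_integral_iff)
  qed
  moreover have "(\<Sum>r. F r x) = indicator {0<..} x *\<^sub>R (x ^ k * f x)" for x
    using F_sums[of x] by (simp add: sums_iff)
  moreover have "integral\<^sup>L lborel (F r) = c r * (fact k / real (Suc r) ^ Suc k)" for r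
    using hb[of r] by (simp add: has_bochner_integral_iff)
  ultimately show ?thesis by (simp add: set_lebesgue_integral_def sums_iff)
qed

lemma summable_zeta3: "summable (\<lambda>k. 1 / (real (Suc k)) ^ 3)"
proof -
  have "summable (\<lambda>k. inverse (real k ^ 3))" by (rule inverse_power_summable) simp
  then have "summable (\<lambda>k. inverse (real (Suc k) ^ 3))" by (rule summable_Suc_iff[THEN iffD2])
  then show ?thesis by (simp add: inverse_eq_divide)
qed

lemma zeta3_pos: "0 < zeta3"
  unfolding zeta3_def by (rule suminf_pos[OF summable_zeta3]) simp

text \<open>The geometric series in \<open>exp (- x)\<close> and its derivative, since
  \<open>q / (1 - q)\<^sup>2 = b + b\<^sup>2\<close> for \<open>b = q / (1 - q)\<close>.\<close>

lemma bose_sums: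
  assumes "0 < x"
  shows "(\<lambda>r. 1 * exp (- real (Suc r) * x)) sums bose x"
    and "(\<lambda>r. real (Suc r) * exp (- real (Suc r) * x)) sums (bose x + (bose x)\<^sup>2)"
proof -
  have e: "exp (- real (Suc r) * x) = exp (- x) * exp (- x) ^ r" for r
    using exp_of_nat_mult[of "Suc r" "- x"] by (simp only: power_Suc mult_minus_left mult_minus_right)
  have n: "norm (exp (- x)) < 1" using assms by simp
  have b: "bose x = exp (- x) * (1 / (1 - exp (- x)))"
    using assms by (simp add: bose_def exp_minus field_simps)
  show "(\<lambda>r. 1 * exp (- real (Suc r) * x)) sums bose x"
    unfolding e b using sums_mult[OF geometric_sums[OF n]] by simp
  have "1 - exp (- x) \<noteq> 0" using assms by simp
  then have b2: "bose x + (bose x)\<^sup>2 = exp (- x) * (1 / (1 - exp (- x))\<^sup>2)"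
  proof -
    have "(1 - d) * (1 / d) + ((1 - d) * (1 / d))\<^sup>2 = (1 - d) * (1 / d\<^sup>2)" if "d \<noteq> 0" for d :: real
      using that by (simp add: field_simps power2_eq_square)
    from this[of "1 - exp (- x)"] \<open>1 - exp (- x) \<noteq> 0\<close> show ?thesis unfolding b by simp
  qed
  have "(\<lambda>r. exp (- x) * (of_nat (Suc r) * exp (- x) ^ r)) sums (exp (- x) * (1 / (1 - exp (- x))\<^sup>2))"
    using sums_mult[OF geometric_deriv_sums[OF n]] .
  then show "(\<lambda>r. real (Suc r) * exp (- real (Suc r) * x)) sums (bose x + (bose x)\<^sup>2)"
    unfolding e b2 by (simp add: mult_ac)
qed

lemma integral_bose: "(LINT x:{0<..}|lborel. x ^ 2 * bose x) = 2 * zeta3"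
proof -
  have e: "1 * (fact 2 / real (Suc r) ^ Suc 2) = 2 * (1 / (real (Suc r)) ^ 3)" for r
    by (simp add: numeral_3_eq_3)
  have "(LINT x:{0<..}|lborel. x ^ 2 * bose x) = (\<Sum>r. 1 * (fact 2 / real (Suc r) ^ Suc 2))"
    by (rule integral_exp_series[OF _ bose_sums(1)]) (simp, assumption, unfold e, rule summable_mult[OF summable_zeta3])
  then show ?thesis unfolding e zeta3_def by (simp only: suminf_mult[OF summable_zeta3])
qed

text \<open>The coefficient \<open>Suc r\<close> cancels one of the four powers in the denominator,
  so \<zeta>(3) appears again, now with factor 3! instead of 2!.\<close>

lemma integral_bose_var: "(LINT x:{0<..}|lborel. x ^ 3 * (bose x + (bose x)\<^sup>2)) = 6 * zeta3"
proof -
  have e: "real (Suc r) * (fact 3 / real (Suc r) ^ Suc 3) = 6 * (1 / (real (Suc r)) ^ 3)" for r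
  proof -
    have "y * (6 / y ^ 4) = 6 * (1 / y ^ 3)" if "0 < y" for y :: real
      using that by (simp add: field_simps power_numeral_reduce)
    moreover have "fact 3 = (6 :: real)" "Suc 3 = 4" by (simp_all add: fact_numeral)
    ultimately show ?thesis by (simp only: of_nat_0_less_iff zero_less_Suc)
  qed
  have "(LINT x:{0<..}|lborel. x ^ 3 * (bose x + (bose x)\<^sup>2)) = (\<Sum>r. real (Suc r) * (fact 3 / real (Suc r) ^ Suc 3))"
    by (rule integral_exp_series[OF _ bose_sums(2)]) (simp, assumption, unfold e, rule summable_mult[OF summable_zeta3])
  then show ?thesis unfolding e zeta3_def by (simp only: suminf_mult[OF summable_zeta3])
qed

subsection \<open>The saddle point\<close>

lemma ex_saddle:
  assumes "n > 0"
  shows "\<exists>\<tau>>0. (\<Sum>m=1..n. real m ^ 2 * bose (\<tau> * real m)) = real n"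
proof -
  let ?f = "\<lambda>\<tau>. \<Sum>m=1..n. real m ^ 2 * bose (\<tau> * real m)"
  \<comment> \<open>Chosen so that \<open>bose a = n\<close>: the single term for
    \<open>m = 1\<close> already reaches the target.\<close>
  define a where "a = ln (1 + 1 / real n)"
  have a: "0 < a" unfolding a_def by (intro ln_gt_zero) (use assms in simp)
  have "a \<le> 1 / real n" unfolding a_def by (rule ln_add_one_self_le_self) simp
  also have "\<dots> \<le> real n" using assms by (simp add: field_simps) (metis One_nat_def Suc_leI mult_le_mono nat_mult_1 of_nat_1 of_nat_le_iff of_nat_mult)
  finally have an: "a \<le> real n" .
  have "real n = bose a" using assms by (simp add: bose_def a_def add_pos_nonneg)
  also have "\<dots> = (\<Sum>m\<in>{1}. real m ^ 2 * bose (a * real m))" by simp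
  also have "\<dots> \<le> ?f a"
    using assms a by (intro sum_mono2) (auto intro!: mult_nonneg_nonneg less_imp_le[OF bose_pos])
  finally have fa: "real n \<le> ?f a" .
  \<comment> \<open>At the other endpoint \<open>bose x \<le> 1 / x\<close> bounds each term by
    \<open>m / n\<close>, hence by 1.\<close>
  have "?f (real n) \<le> (\<Sum>m=1..n. real m ^ 2 * (1 / (real n * real m)))"
    using assms by (intro sum_mono mult_left_mono bose_le) auto
  also have "\<dots> \<le> (\<Sum>m=1..n. 1)"
    using assms by (intro sum_mono) (auto simp: power2_eq_square)
  finally have fn: "?f (real n) \<le> real n" by simp
  have "continuous_on {a..real n} ?f"
    using a by (intro continuous_intros) auto
  from IVT2'[OF fn fa an this] show ?thesis using a by (meson less_le_trans)
qed

text \<open>The parameter for which the expected size in the Boltzmann model is exactly \<open>n\<close>; this makes the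
  linear term of the exponent at the saddle point vanish identically.\<close>

definition saddle :: "nat \<Rightarrow> real" where
  "saddle n = (if n = 0 then 1 else SOME \<tau>. 0 < \<tau> \<and> (\<Sum>m=1..n. real m ^ 2 * bose (\<tau> * real m)) = real n)"

text \<open>The default 1 at \<open>n = 0\<close> makes positivity unconditional, as
  \<open>riemann_sum_limit\<close> requires for every index.\<close>

lemma saddle_props:
  "0 < saddle n" "n > 0 \<Longrightarrow> (\<Sum>m=1..n. real m ^ 2 * bose (saddle n * real m)) = real n"
proof -
  have "0 < saddle n \<and> (\<Sum>m=1..n. real m ^ 2 * bose (saddle n * real m)) = real n" if "n > 0"
    using someI_ex[OF ex_saddle[OF that]] that by (simp add: saddle_def)
  then show "0 < saddle n" "n > 0 \<Longrightarrow> (\<Sum>m=1..n. real m ^ 2 * bose (saddle n * real m)) = real n"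
    by (cases "n = 0"; simp add: saddle_def)+
qed

text \<open>One Bose factor supplies the exponential decay and each of the others at most
  \<open>1 / x\<close>; the condition \<open>j \<le> k\<close> lets the power of \<open>x\<close>
  absorb the poles.\<close>

lemma power_mult_bose_le:
  assumes "0 < x" "1 \<le> j" "j \<le> k"
  shows "x ^ k * bose x ^ j \<le> 2 * 4 ^ (k - j) * fact (k - j) * exp (- x / 4)"
proof -
  have "bose x ^ j \<le> 2 * exp (- x / 2) / x ^ j"
  proof -
    obtain i where j: "j = Suc i" using assms by (cases j) auto
    have "bose x * bose x ^ i \<le> (2 * exp (- x / 2) / x) * (1 / x) ^ i"
      using assms bose_le[of x] bose_pos[of x] by (intro mult_mono power_mono) auto
    then show ?thesis by (simp add: j power_divide)
  qed
  then have "x ^ k * bose x ^ j \<le> x ^ k * (2 * exp (- x / 2) / x ^ j)"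
    using assms by (intro mult_left_mono) auto
  also have "\<dots> = 2 * (x ^ (k - j) * exp (- x / 2))"
    using assms by (simp add: power_diff)
  also have "\<dots> \<le> 2 * (4 ^ (k - j) * fact (k - j) * exp (- x / 4))"
    using assms by (intro mult_left_mono power_mult_exp_le) auto
  finally show ?thesis by (simp add: mult.assoc)
qed

text \<open>An a priori bound: the Riemann sum limit presupposes that the saddle tends to 0, so this
  has to be shown directly. The constant is 8 from \<open>power_mult_bose_le\<close> times 4 from
  \<open>bose (\<tau> / 4) \<le> 4 / \<tau>\<close>.\<close>

lemma saddle_cube_le: "real n * saddle n ^ 3 \<le> 32"
proof (cases "n = 0")
  case False
  let ?\<tau> = "saddle n"
  have t: "0 < ?\<tau>" by (rule saddle_props)
  have e: "0 < exp (- ?\<tau> / 4)" "exp (- ?\<tau> / 4) < 1" using t by auto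
  have "real n * ?\<tau>\<^sup>2 = (\<Sum>m=1..n. (?\<tau> * real m) ^ 2 * bose (?\<tau> * real m) ^ 1)"
    using saddle_props(2)[of n, symmetric] False
    by (simp add: sum_distrib_left power_mult_distrib mult_ac)
  also have "\<dots> \<le> (\<Sum>m=1..n. 2 * 4 ^ (2 - 1) * fact (2 - 1) * exp (- (?\<tau> * real m) / 4))"
    using t by (intro sum_mono power_mult_bose_le) auto
  also have "\<dots> = 8 * (\<Sum>m=1..n. exp (- ?\<tau> / 4) ^ m)"
    by (simp add: sum_distrib_left exp_of_nat_mult[symmetric] mult_ac)
  also have "(\<Sum>m=1..n. exp (- ?\<tau> / 4) ^ m) \<le> bose (?\<tau> / 4)"
  proof -
    have "(\<Sum>m=1..n. exp (- ?\<tau> / 4) ^ m) = (\<Sum>r<n. 1 * exp (- real (Suc r) * (?\<tau> / 4)))"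
      by (rule sum.reindex_bij_witness[where i = Suc and j = "\<lambda>m. m - 1"])
         (auto simp: exp_of_nat_mult[symmetric] mult_ac)
    also have "\<dots> \<le> (\<Sum>r. 1 * exp (- real (Suc r) * (?\<tau> / 4)))"
      using bose_sums(1)[of "?\<tau> / 4"] t by (intro sum_le_suminf) (auto dest: sums_summable)
    also have "\<dots> = bose (?\<tau> / 4)"
      using bose_sums(1)[of "?\<tau> / 4"] t by (simp add: sums_iff)
    finally show ?thesis .
  qed
  also have "bose (?\<tau> / 4) \<le> 1 / (?\<tau> / 4)" using t by (intro bose_le) auto
  finally have "real n * ?\<tau>\<^sup>2 \<le> 32 / ?\<tau>" by simp
  then show ?thesis using t by (simp add: field_simps power3_eq_cube power2_eq_square)
qed simp

lemma saddle_tendsto_0: "saddle \<longlonglongrightarrow> 0"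
proof -
  have "(\<lambda>n. saddle n ^ 3) \<longlonglongrightarrow> 0"
  proof (rule tendsto_sandwich)
    show "\<forall>\<^sub>F n in sequentially. 0 \<le> saddle n ^ 3" using saddle_props(1) by (simp add: less_imp_le)
    show "\<forall>\<^sub>F n in sequentially. saddle n ^ 3 \<le> 32 / real n"
      using eventually_gt_at_top[of 0]
      by eventually_elim (use saddle_cube_le in \<open>simp add: field_simps\<close>)
    show "(\<lambda>n. 32 / real n) \<longlonglongrightarrow> 0" by (rule lim_const_over_n)
  qed simp
  then have "(\<lambda>n. root 3 (saddle n ^ 3)) \<longlonglongrightarrow> root 3 0" by (rule tendsto_real_root)
  moreover have "root 3 (saddle n ^ 3) = saddle n" for n
    using saddle_props(1)[of n] by (simp add: real_root_power_cancel)
  ultimately show ?thesis by simp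
qed

text \<open>All terms of the saddle equation satisfy
  \<open>bose (\<tau> * m) \<ge> exp (- n * \<tau>)\<close>, so the equation forces
  \<open>n \<ge> exp (- n * \<tau>) * n ^ 3 / 3\<close>. The product \<open>n * \<tau>\<close> thus
  grows at least logarithmically.\<close>

lemma saddle_mult_at_top: "filterlim (\<lambda>n. real n * saddle n) at_top sequentially"
proof (rule filterlim_at_top_mono)
  have "filterlim (\<lambda>n. 1/3 * real n ^ 2) at_top sequentially"
    by (intro filterlim_tendsto_pos_mult_at_top[OF tendsto_const] filterlim_pow_at_top filterlim_real_sequentially) auto
  then show "filterlim (\<lambda>n. ln (1/3 * real n ^ 2)) at_top sequentially"
    by (rule filterlim_compose[OF ln_at_top])
  show "\<forall>\<^sub>F n in sequentially. ln (1/3 * real n ^ 2) \<le> real n * saddle n"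
    using eventually_gt_at_top[of 0]
  proof eventually_elim
    case (elim n)
    let ?\<tau> = "saddle n"
    have t: "0 < ?\<tau>" by (rule saddle_props)
    have c: "real n ^ 3 \<le> 3 * (\<Sum>m=1..n. real m ^ 2)" for n
      by (induction n) (auto simp: power2_eq_square power3_eq_cube algebra_simps)
    have "exp (- (real n * ?\<tau>)) * (\<Sum>m=1..n. real m ^ 2) \<le> (\<Sum>m=1..n. real m ^ 2 * bose (?\<tau> * real m))"
      unfolding sum_distrib_left
    proof (intro sum_mono)
      fix m assume m: "m \<in> {1..n}"
      have "exp (- (real n * ?\<tau>)) \<le> exp (- (?\<tau> * real m))" using m t by (simp add: mult.commute)
      also have "\<dots> \<le> bose (?\<tau> * real m)"
        using m t by (simp add: bose_def exp_minus inverse_eq_divide frac_le)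
      finally show "exp (- (real n * ?\<tau>)) * real m ^ 2 \<le> real m ^ 2 * bose (?\<tau> * real m)"
        by (subst mult.commute) (rule mult_left_mono, auto)
    qed
    also have "\<dots> = real n" using saddle_props(2) elim by simp
    finally have "exp (- (real n * ?\<tau>)) * (\<Sum>m=1..n. real m ^ 2) \<le> real n" .
    moreover have "exp (- (real n * ?\<tau>)) * real n ^ 3 \<le> exp (- (real n * ?\<tau>)) * (3 * (\<Sum>m=1..n. real m ^ 2))"
      by (intro mult_left_mono c) simp
    ultimately have "exp (- (real n * ?\<tau>)) * real n ^ 3 \<le> 3 * real n"
      by (simp only: mult.left_commute[of _ 3])
    then have "1/3 * real n ^ 2 \<le> exp (real n * ?\<tau>)"
      using elim by (simp add: exp_minus field_simps power2_eq_square power3_eq_cube)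
    then have "ln (1/3 * real n ^ 2) \<le> ln (exp (real n * ?\<tau>))"
      using elim by (subst ln_le_cancel_iff) auto
    then show ?case by simp
  qed
qed

lemmas saddle_riemann = riemann_sum_limit[OF saddle_props(1) saddle_tendsto_0 saddle_mult_at_top]

lemma saddle_moment_limit:
  assumes "1 \<le> j" "j \<le> k"
  shows "(\<lambda>n. saddle n ^ Suc k * (\<Sum>m=1..n. real m ^ k * bose (saddle n * real m) ^ j))
     \<longlonglongrightarrow> (LINT x:{0<..}|lborel. x ^ k * bose x ^ j)"
proof -
  have "(\<lambda>n. saddle n * (\<Sum>m=1..n. (saddle n * real m) ^ k * bose (saddle n * real m) ^ j))
     \<longlonglongrightarrow> (LINT x:{0<..}|lborel. x ^ k * bose x ^ j)"
  proof (rule saddle_riemann[where g = "\<lambda>x. x ^ k * bose x ^ j" and C = "2 * 4 ^ (k - j) * fact (k - j)"])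
    show "continuous_on {0<..} (\<lambda>x. x ^ k * bose x ^ j)" by (intro continuous_intros) auto
    show "\<bar>x ^ k * bose x ^ j\<bar> \<le> 2 * 4 ^ (k - j) * fact (k - j) * exp (- x / 4)" if "0 < x" for x
      using power_mult_bose_le[OF that assms] bose_pos[OF that] that by simp
  qed
  then show ?thesis by (simp add: sum_distrib_left power_mult_distrib mult_ac)
qed

lemma saddle_moment_tendsto_0:
  assumes "1 \<le> j" "j \<le> k"
  shows "(\<lambda>n. saddle n ^ (k + 2) * (\<Sum>m=1..n. real m ^ k * bose (saddle n * real m) ^ j)) \<longlonglongrightarrow> 0"
  using tendsto_mult[OF saddle_tendsto_0 saddle_moment_limit[OF assms]] by (simp add: mult_ac)

lemma saddle_mean_limit: "(\<lambda>n. real n * saddle n ^ 3) \<longlonglongrightarrow> 2 * zeta3"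
proof -
  have "(\<lambda>n. saddle n ^ Suc 2 * (\<Sum>m=1..n. real m ^ 2 * bose (saddle n * real m) ^ 1)) \<longlonglongrightarrow> 2 * zeta3"
    using saddle_moment_limit[of 1 2] integral_bose by simp
  moreover have "\<forall>\<^sub>F n in sequentially. saddle n ^ Suc 2 * (\<Sum>m=1..n. real m ^ 2 * bose (saddle n * real m) ^ 1) = real n * saddle n ^ 3"
    using eventually_gt_at_top[of 0]
    by eventually_elim (use saddle_props(2) in \<open>simp add: numeral_3_eq_3\<close>)
  ultimately show ?thesis by (rule Lim_transform_eventually)
qed

lemma saddle_variance_limit:
  "(\<lambda>n. saddle n ^ 4 * (\<Sum>m=1..n. real m ^ 3 * (bose (saddle n * real m) + (bose (saddle n * real m))\<^sup>2))) \<longlonglongrightarrow> 6 * zeta3"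
proof -
  have "(\<lambda>n. saddle n * (\<Sum>m=1..n. (saddle n * real m) ^ 3 * (bose (saddle n * real m) + (bose (saddle n * real m))\<^sup>2)))
     \<longlonglongrightarrow> 6 * zeta3"
    unfolding integral_bose_var[symmetric]
  \<comment> \<open>The constant is 64 + 8, the bounds of \<open>power_mult_bose_le\<close> for
    \<open>k = 3\<close> with \<open>j = 1\<close> and \<open>j = 2\<close>.\<close>
  proof (rule saddle_riemann[where g = "\<lambda>x. x ^ 3 * (bose x + (bose x)\<^sup>2)" and C = 72])
    show "continuous_on {0<..} (\<lambda>x. x ^ 3 * (bose x + (bose x)\<^sup>2))" by (intro continuous_intros) auto
    show "\<bar>x ^ 3 * (bose x + (bose x)\<^sup>2)\<bar> \<le> 72 * exp (- x / 4)" if "0 < x" for x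
      using power_mult_bose_le[OF that, of 1 3] power_mult_bose_le[OF that, of 2 3] bose_pos[OF that] that
      by (simp add: distrib_left fact_numeral)
  qed
  moreover have "saddle n * (\<Sum>m=1..n. (saddle n * real m) ^ 3 * (bose (saddle n * real m) + (bose (saddle n * real m))\<^sup>2))
    = saddle n ^ 4 * (\<Sum>m=1..n. real m ^ 3 * (bose (saddle n * real m) + (bose (saddle n * real m))\<^sup>2))" for n
    unfolding sum_distrib_left by (intro sum.cong refl) (simp add: power_mult_distrib power_numeral_reduce mult_ac)
  ultimately show ?thesis by simp
qed

subsection \<open>The integrand near the saddle point\<close>

lemma cis_taylor:
  "norm (cis t - 1) \<le> \<bar>t\<bar>"
  "norm (cis t - 1 - \<i> * t) \<le> t\<^sup>2 / 2"
  "norm (cis t - 1 - \<i> * t + t\<^sup>2 / 2) \<le> \<bar>t\<bar> ^ 3 / 6"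
  using iexp_approx1[of t 0] iexp_approx1[of t 1] iexp_approx1[of t 2]
  by (simp_all add: cis_conv_exp numeral_2_eq_2 numeral_3_eq_3 algebra_simps fact_numeral)

text \<open>The left-hand expression vanishes at 0 and has derivative
  \<open>- w\<^sup>2 / (1 - w)\<close>, whose denominator has modulus at least 1/2 on the
  disc.\<close>

lemma norm_ln_one_minus_le:
  fixes z :: complex
  assumes "norm z \<le> 1/2"
  shows "norm (Ln (1 - z) + z + z\<^sup>2 / 2) \<le> 2 * norm z ^ 3"
proof -
  have "norm ((Ln (1 - z) + z + z\<^sup>2 / 2) - (Ln (1 - 0) + 0 + 0\<^sup>2 / 2)) \<le> 2 * (norm z)\<^sup>2 * norm (z - 0)"
  proof (rule field_differentiable_bound[where S = "cball 0 (norm z)" and f' = "\<lambda>w. - (w\<^sup>2) / (1 - w)"])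
    fix w :: complex assume "w \<in> cball 0 (norm z)"
    then have w: "norm w \<le> norm z" "norm w \<le> 1/2" using assms by auto
    have r: "1/2 \<le> norm (1 - w)" using norm_triangle_ineq2[of 1 w] w by simp
    have "Re w \<le> 1/2" using w(2) complex_Re_le_cmod order.trans by blast
    then have nn: "1 - w \<notin> \<real>\<^sub>\<le>\<^sub>0" by (auto simp: complex_nonpos_Reals_iff)
    have "w \<noteq> 1" using r by auto
    then show "((\<lambda>z. Ln (1 - z) + z + z\<^sup>2 / 2) has_field_derivative - (w\<^sup>2) / (1 - w)) (at w within cball 0 (norm z))"
      using nn by (auto intro!: derivative_eq_intros simp: field_simps power2_eq_square)
    have "norm (- (w\<^sup>2) / (1 - w)) = (norm w)\<^sup>2 / norm (1 - w)"
      by (simp add: norm_divide norm_power)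
    also have "\<dots> \<le> (norm z)\<^sup>2 / (1/2)"
      using w r by (intro frac_le power_mono) auto
    finally show "norm (- (w\<^sup>2) / (1 - w)) \<le> 2 * (norm z)\<^sup>2" by simp
  qed auto
  then show ?thesis by (simp add: power2_eq_square power3_eq_cube mult_ac)
qed

text \<open>Second order cumulant expansion of a geometric variable with mean \<open>b\<close>. In
  its variance, \<open>b\<close> comes from the Taylor expansion of \<open>cis\<close> and
  \<open>b\<^sup>2\<close> from the quadratic term of the logarithm.\<close>

lemma ln_geometric_factor:
  fixes b t :: real
  assumes "0 \<le> b" "b * \<bar>t\<bar> \<le> 1/2"
  shows "norm (- Ln (1 - of_real b * (cis t - 1)) - (\<i> * of_real (b * t) - of_real ((b + b\<^sup>2) * t\<^sup>2 / 2)))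
    \<le> 2 * (b + b\<^sup>2 + b ^ 3) * \<bar>t\<bar> ^ 3"
proof -
  define z where "z = of_real b * (cis t - 1)"
  have z: "norm z \<le> b * \<bar>t\<bar>"
    using assms cis_taylor(1)[of t] by (simp add: z_def norm_mult mult_left_mono)
  \<comment> \<open>The three sources of error: \<open>R1\<close> is the Taylor remainder of
    \<open>cis\<close>, \<open>R2\<close> equals \<open>(cis t - 1)\<^sup>2 + t\<^sup>2\<close>, and
    \<open>R3\<close> is the remainder of the logarithm.\<close>
  define R1 where "R1 = cis t - 1 - \<i> * t + t\<^sup>2 / 2"
  define R2 where "R2 = (cis t - 1 - \<i> * t) * (cis t - 1 + \<i> * t)"
  define R3 where "R3 = Ln (1 - z) + z + z\<^sup>2 / 2"
  have R1: "norm R1 \<le> \<bar>t\<bar> ^ 3 / 6" unfolding R1_def by (rule cis_taylor)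
  have "norm (cis t - 1 + \<i> * t) \<le> 2 * \<bar>t\<bar>"
    using norm_triangle_ineq[of "cis t - 1" "\<i> * t"] cis_taylor(1)[of t] by (simp add: norm_mult)
  then have "norm R2 \<le> t\<^sup>2 / 2 * (2 * \<bar>t\<bar>)"
    unfolding R2_def norm_mult by (intro mult_mono cis_taylor) auto
  then have R2: "norm R2 \<le> \<bar>t\<bar> ^ 3" by (simp add: power2_eq_square power3_eq_cube abs_mult_self_eq)
  have "norm R3 \<le> 2 * norm z ^ 3"
    unfolding R3_def using z assms by (intro norm_ln_one_minus_le) auto
  also have "\<dots> \<le> 2 * (b * \<bar>t\<bar>) ^ 3" using z by (intro mult_left_mono power_mono) auto
  finally have R3: "norm R3 \<le> 2 * (b ^ 3 * \<bar>t\<bar> ^ 3)" by (simp add: power_mult_distrib)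
  have "- Ln (1 - z) - (\<i> * of_real (b * t) - of_real ((b + b\<^sup>2) * t\<^sup>2 / 2))
     = of_real b * R1 + of_real (b\<^sup>2 / 2) * R2 - R3"
    unfolding R1_def R2_def R3_def z_def by (simp add: field_simps power2_eq_square)
  also have "norm \<dots> \<le> norm (of_real b * R1) + norm (of_real (b\<^sup>2 / 2) * R2) + norm R3"
    by (rule order.trans[OF norm_triangle_ineq4 add_right_mono[OF norm_triangle_ineq]])
  also have "\<dots> \<le> b * (\<bar>t\<bar> ^ 3 / 6) + b\<^sup>2 / 2 * \<bar>t\<bar> ^ 3 + 2 * (b ^ 3 * \<bar>t\<bar> ^ 3)"
    unfolding norm_mult using assms R1 R2 R3 by (intro add_mono mult_mono) (auto simp: norm_power)
  also have "\<dots> \<le> 2 * (b + b\<^sup>2 + b ^ 3) * \<bar>t\<bar> ^ 3"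
  proof -
    have "0 \<le> b * \<bar>t\<bar> ^ 3" "0 \<le> b\<^sup>2 * \<bar>t\<bar> ^ 3" using assms by auto
    moreover have "2 * (b + b\<^sup>2 + b ^ 3) * \<bar>t\<bar> ^ 3 = 2 * (b * \<bar>t\<bar> ^ 3) + 2 * (b\<^sup>2 * \<bar>t\<bar> ^ 3) + 2 * (b ^ 3 * \<bar>t\<bar> ^ 3)"
      by (simp only: distrib_left distrib_right mult.assoc)
    ultimately show ?thesis by linarith
  qed
  finally show ?thesis unfolding z_def .
qed

lemma geometric_factor_eq:
  assumes "0 < \<tau>"
  shows "of_real (1 - exp (- \<tau> * hook x)) / (1 - cell_weight \<tau> \<theta> \<alpha> x) =
     1 / (1 - of_real (bose (\<tau> * hook x)) * (cis (\<alpha> * hook x + \<theta> * skew x) - 1))"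
proof -
  define q where "q = exp (- \<tau> * hook x)"
  define w where "w = cis (\<alpha> * hook x + \<theta> * skew x)"
  have q: "0 < q" "q < 1" using assms hook_pos[of x] by (simp_all add: q_def del: hook_pos)
  have b: "bose (\<tau> * hook x) = q / (1 - q)"
    using q by (simp add: bose_def q_def exp_minus field_simps)
  have "1 - of_real (q / (1 - q)) * (w - 1) = (1 - of_real q * w) / of_real (1 - q)"
    using q by (simp add: field_simps)
  then show ?thesis unfolding b cell_weight_def q_def[symmetric] w_def[symmetric] by simp
qed

section \<open>Linear, quadratic and cubic sums along antidiagonals of constant hook length\<close>

lemma sum_triangle:
  "(\<Sum>x\<in>triangle n. f x) = (\<Sum>m=1..n. \<Sum>a<m. f (a, m - Suc a))"
proof -
  have "(\<Sum>x\<in>triangle n. f x) = (\<Sum>(m, a)\<in>(SIGMA m:{1..n}. {..<m}). f (a, m - Suc a))"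
    by (rule sum.reindex_bij_witness[where i = "\<lambda>(m, a). (a, m - Suc a)" and j = "\<lambda>(a, b). (a + b + 1, a)"])
       (auto simp: triangle_def)
  also have "\<dots> = (\<Sum>m=1..n. \<Sum>a<m. f (a, m - Suc a))"
    by (subst sum.Sigma) auto
  finally show ?thesis .
qed

lemma hook_antidiagonal: "a < m \<Longrightarrow> hook (a, m - Suc a) = real m"
  by (simp add: hook_def of_nat_diff)

lemma skew_antidiagonal: "a < m \<Longrightarrow> skew (a, m - Suc a) = real m - 1 - 2 * real a"
  by (simp add: skew_def of_nat_diff)

lemma sum_arith: "(\<Sum>a<m. c - 2 * real a) = real m * (c - (real m - 1))"
  by (induction m) (auto simp: algebra_simps)

lemma sum_arith_square:
  "3 * (\<Sum>a<m. (c - 2 * real a)\<^sup>2) = real m * (3 * c\<^sup>2 - 6 * c * (real m - 1) + 2 * (real m - 1) * (2 * real m - 1))"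
  by (induction m) (auto simp: algebra_simps power2_eq_square)

text \<open>Transposition reverses the sign of \<open>skew\<close>. This removes the linear term in
  \<open>\<theta>\<close> and the mixed term in \<open>\<alpha>\<close> and
  \<open>\<theta>\<close>.\<close>

lemma sum_skew_antidiagonal: "(\<Sum>a<m. skew (a, m - Suc a)) = 0"
proof -
  have "(\<Sum>a<m. skew (a, m - Suc a)) = (\<Sum>a<m. real m - 1 - 2 * real a)"
    by (intro sum.cong refl) (simp add: skew_antidiagonal)
  then show ?thesis using sum_arith[of "real m - 1" m] by simp
qed

lemma sum_skew_square_antidiagonal: "(\<Sum>a<m. (skew (a, m - Suc a))\<^sup>2) = real m * (real m ^ 2 - 1) / 3"
proof -
  have "(\<Sum>a<m. (skew (a, m - Suc a))\<^sup>2) = (\<Sum>a<m. (real m - 1 - 2 * real a)\<^sup>2)"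
    by (intro sum.cong refl) (simp add: skew_antidiagonal)
  moreover have "3 * (real m - 1)\<^sup>2 - 6 * (real m - 1) * (real m - 1) + 2 * (real m - 1) * (2 * real m - 1) = real m ^ 2 - 1"
    by (simp add: power2_eq_square algebra_simps)
  ultimately show ?thesis using sum_arith_square[of "real m - 1" m] by simp
qed

lemma abs_phase_le: "\<bar>\<alpha> * hook x + \<theta> * skew x\<bar> \<le> (\<bar>\<alpha>\<bar> + \<bar>\<theta>\<bar>) * hook x"
proof -
  have "\<bar>\<alpha> * hook x + \<theta> * skew x\<bar> \<le> \<bar>\<alpha>\<bar> * hook x + \<bar>\<theta>\<bar> * \<bar>skew x\<bar>"
    using abs_triangle_ineq[of "\<alpha> * hook x" "\<theta> * skew x"] hook_pos[of x] by (simp add: abs_mult del: hook_pos)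
  also have "\<dots> \<le> \<bar>\<alpha>\<bar> * hook x + \<bar>\<theta>\<bar> * hook x"
    by (intro add_left_mono mult_left_mono abs_skew_le) auto
  finally show ?thesis by (simp add: algebra_simps)
qed

lemma sum_triangle_linear:
  "(\<Sum>x\<in>triangle n. g (hook x) * (\<alpha> * hook x + \<theta> * skew x)) = \<alpha> * (\<Sum>m=1..n. real m ^ 2 * g (real m))"
proof -
  have "(\<Sum>a<m. g (hook (a, m - Suc a)) * (\<alpha> * hook (a, m - Suc a) + \<theta> * skew (a, m - Suc a))) = \<alpha> * (real m ^ 2 * g (real m))" for m
  proof -
    have "(\<Sum>a<m. g (hook (a, m - Suc a)) * (\<alpha> * hook (a, m - Suc a) + \<theta> * skew (a, m - Suc a)))
       = (\<Sum>a<m. g (real m) * (\<alpha> * real m) + g (real m) * \<theta> * skew (a, m - Suc a))"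
      by (intro sum.cong refl) (simp add: hook_antidiagonal algebra_simps)
    also have "\<dots> = \<alpha> * (real m ^ 2 * g (real m)) + g (real m) * \<theta> * (\<Sum>a<m. skew (a, m - Suc a))"
      by (simp add: sum.distrib sum_distrib_left power2_eq_square)
    finally show ?thesis by (simp add: sum_skew_antidiagonal)
  qed
  then show ?thesis by (simp add: sum_triangle sum_distrib_left)
qed

text \<open>The subtracted sum stems from the \<open>- 1\<close> in \<open>m ^ 2 - 1\<close>, the
  exact second moment of an arithmetic progression; it is of lower order.\<close>

lemma sum_triangle_quadratic:
  "(\<Sum>x\<in>triangle n. g (hook x) * (\<alpha> * hook x + \<theta> * skew x)\<^sup>2)
    = (\<alpha>\<^sup>2 + \<theta>\<^sup>2 / 3) * (\<Sum>m=1..n. real m ^ 3 * g (real m)) - \<theta>\<^sup>2 / 3 * (\<Sum>m=1..n. real m * g (real m))"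
proof -
  have "(\<Sum>a<m. g (hook (a, m - Suc a)) * (\<alpha> * hook (a, m - Suc a) + \<theta> * skew (a, m - Suc a))\<^sup>2)
     = (\<alpha>\<^sup>2 + \<theta>\<^sup>2 / 3) * (real m ^ 3 * g (real m)) - \<theta>\<^sup>2 / 3 * (real m * g (real m))" for m
  proof -
    have "(\<Sum>a<m. g (hook (a, m - Suc a)) * (\<alpha> * hook (a, m - Suc a) + \<theta> * skew (a, m - Suc a))\<^sup>2)
       = (\<Sum>a<m. g (real m) * (\<alpha> * real m)\<^sup>2 + 2 * g (real m) * \<alpha> * \<theta> * real m * skew (a, m - Suc a) + g (real m) * \<theta>\<^sup>2 * (skew (a, m - Suc a))\<^sup>2)"
      by (intro sum.cong refl) (simp add: hook_antidiagonal algebra_simps power2_eq_square)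
    also have "\<dots> = real m * (g (real m) * (\<alpha> * real m)\<^sup>2) + 2 * g (real m) * \<alpha> * \<theta> * real m * (\<Sum>a<m. skew (a, m - Suc a)) + g (real m) * \<theta>\<^sup>2 * (\<Sum>a<m. (skew (a, m - Suc a))\<^sup>2)"
      by (simp add: sum.distrib sum_distrib_left)
    finally show ?thesis
      unfolding sum_skew_antidiagonal sum_skew_square_antidiagonal
      by (simp add: power2_eq_square power3_eq_cube field_simps)
  qed
  then show ?thesis by (simp add: sum_triangle sum_distrib_left sum_subtractf)
qed

lemma sum_triangle_cubic_le:
  assumes "\<And>x. 0 \<le> g x"
  shows "(\<Sum>x\<in>triangle n. g (hook x) * \<bar>\<alpha> * hook x + \<theta> * skew x\<bar> ^ 3)
    \<le> (\<bar>\<alpha>\<bar> + \<bar>\<theta>\<bar>) ^ 3 * (\<Sum>m=1..n. real m ^ 4 * g (real m))"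
proof -
  have "(\<Sum>x\<in>triangle n. g (hook x) * \<bar>\<alpha> * hook x + \<theta> * skew x\<bar> ^ 3)
     \<le> (\<Sum>x\<in>triangle n. g (hook x) * ((\<bar>\<alpha>\<bar> + \<bar>\<theta>\<bar>) * hook x) ^ 3)"
    using assms by (intro sum_mono mult_left_mono power_mono abs_phase_le) auto
  also have "\<dots> = (\<bar>\<alpha>\<bar> + \<bar>\<theta>\<bar>) ^ 3 * (\<Sum>m=1..n. real m ^ 4 * g (real m))"
    unfolding sum_triangle sum_distrib_left
    by (intro sum.cong refl) (simp add: hook_antidiagonal power_mult_distrib power_numeral_reduce mult_ac)
  finally show ?thesis .
qed

text \<open>The last factor is the Fourier kernel; at the saddle point it cancels the phase of the
  mean size exactly.\<close>

definition rescaled_cf :: "nat \<Rightarrow> real \<Rightarrow> real \<Rightarrow> complex" where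
  "rescaled_cf n v u = boltzmann_cf n (saddle n) (v * saddle n ^ 2) (u * saddle n ^ 2) * cis (- real n * (u * saddle n ^ 2))"

text \<open>The moment limits do not cover \<open>m * bose\<^sup>2\<close>, whose integrand behaves
  like \<open>1 / x\<close> at 0. Replacing \<open>m\<close> by \<open>m ^ 2\<close> repairs this
  and still leaves a spare power of the saddle.\<close>

lemma saddle_second_order_tendsto_0:
  "(\<lambda>n. saddle n ^ 4 * (\<Sum>m=1..n. real m * (bose (saddle n * real m) + (bose (saddle n * real m))\<^sup>2))) \<longlonglongrightarrow> 0"
proof (rule tendsto_sandwich)
  have b: "0 \<le> bose (saddle n * real m)" if "m \<ge> 1" for n m
    using that saddle_props(1)[of n] by (intro less_imp_le[OF bose_pos]) auto
  show "\<forall>\<^sub>F n in sequentially. 0 \<le> saddle n ^ 4 * (\<Sum>m=1..n. real m * (bose (saddle n * real m) + (bose (saddle n * real m))\<^sup>2))"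
    using b by (intro always_eventually allI mult_nonneg_nonneg sum_nonneg) auto
  show "\<forall>\<^sub>F n in sequentially. saddle n ^ 4 * (\<Sum>m=1..n. real m * (bose (saddle n * real m) + (bose (saddle n * real m))\<^sup>2))
     \<le> saddle n ^ (2 + 2) * (\<Sum>m=1..n. real m ^ 2 * bose (saddle n * real m) ^ 1) + saddle n ^ (2 + 2) * (\<Sum>m=1..n. real m ^ 2 * bose (saddle n * real m) ^ 2)"
  proof (intro always_eventually allI)
    fix n
    have "(\<Sum>m=1..n. real m * (bose (saddle n * real m) + (bose (saddle n * real m))\<^sup>2))
       \<le> (\<Sum>m=1..n. real m ^ 2 * (bose (saddle n * real m) + (bose (saddle n * real m))\<^sup>2))"
      using b by (intro sum_mono mult_right_mono) (auto simp: power2_eq_square)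
    then have "saddle n ^ 4 * (\<Sum>m=1..n. real m * (bose (saddle n * real m) + (bose (saddle n * real m))\<^sup>2))
       \<le> saddle n ^ 4 * (\<Sum>m=1..n. real m ^ 2 * (bose (saddle n * real m) + (bose (saddle n * real m))\<^sup>2))"
      by (intro mult_left_mono) auto
    then show "saddle n ^ 4 * (\<Sum>m=1..n. real m * (bose (saddle n * real m) + (bose (saddle n * real m))\<^sup>2))
     \<le> saddle n ^ (2 + 2) * (\<Sum>m=1..n. real m ^ 2 * bose (saddle n * real m) ^ 1) + saddle n ^ (2 + 2) * (\<Sum>m=1..n. real m ^ 2 * bose (saddle n * real m) ^ 2)"
      by (simp add: distrib_left sum.distrib)
  qed
  show "(\<lambda>n. saddle n ^ (2 + 2) * (\<Sum>m=1..n. real m ^ 2 * bose (saddle n * real m) ^ 1) + saddle n ^ (2 + 2) * (\<Sum>m=1..n. real m ^ 2 * bose (saddle n * real m) ^ 2)) \<longlonglongrightarrow> 0"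
    by (intro tendsto_add_zero saddle_moment_tendsto_0) auto
qed simp

text \<open>The frequency \<open>v\<close> varies with \<open>n\<close>, because
  \<open>t / n powr (2/3)\<close> is a constant multiple of \<open>saddle n ^ 2\<close> only
  asymptotically.\<close>

lemma rescaled_cf_limit:
  assumes v: "v \<longlonglongrightarrow> v0"
  shows "(\<lambda>n. rescaled_cf n (v n) u) \<longlonglongrightarrow> of_real (exp (- 3 * zeta3 * (u\<^sup>2 + v0\<^sup>2 / 3)))"
proof -
  define b where "b n x = bose (saddle n * hook x)" for n x
  define t where "t n x = u * saddle n ^ 2 * hook x + v n * saddle n ^ 2 * skew x" for n x
  define L where "L n x = - Ln (1 - of_real (b n x) * (cis (t n x) - 1))" for n x
  define Q where "Q n = (\<Sum>x\<in>triangle n. (b n x + (b n x)\<^sup>2) * (t n x)\<^sup>2)" for n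
  define R where "R n = (\<Sum>x\<in>triangle n. L n x - (\<i> * of_real (b n x * t n x) - of_real ((b n x + (b n x)\<^sup>2) * (t n x)\<^sup>2 / 2)))" for n
  define V where "V n = saddle n ^ 4 * (\<Sum>m=1..n. real m ^ 3 * (bose (saddle n * real m) + (bose (saddle n * real m))\<^sup>2))" for n
  define W where "W n = saddle n ^ 4 * (\<Sum>m=1..n. real m * (bose (saddle n * real m) + (bose (saddle n * real m))\<^sup>2))" for n
  have b0: "0 \<le> b n x" for n x
    unfolding b_def using saddle_props(1)[of n] by (intro less_imp_le[OF bose_pos]) simp
  \<comment> \<open>\<open>bose x \<le> 1 / x\<close> absorbs the hook length in the phase, so the
    logarithm can be expanded in all cells simultaneously.\<close>
  have bt: "b n x * \<bar>t n x\<bar> \<le> saddle n * (\<bar>u\<bar> + \<bar>v n\<bar>)" for n x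
  proof -
    have s: "0 < saddle n" by (rule saddle_props)
    have "b n x * \<bar>t n x\<bar> \<le> 1 / (saddle n * hook x) * ((\<bar>u * saddle n ^ 2\<bar> + \<bar>v n * saddle n ^ 2\<bar>) * hook x)"
      unfolding b_def t_def using s by (intro mult_mono bose_le abs_phase_le) (auto simp: less_imp_le)
    also have "\<dots> = saddle n * (\<bar>u\<bar> + \<bar>v n\<bar>)"
      using s hook_pos[of x] by (simp add: abs_mult field_simps power2_eq_square del: hook_pos)
    finally show ?thesis .
  qed
  have "(\<lambda>n. saddle n * (\<bar>u\<bar> + \<bar>v n\<bar>)) \<longlonglongrightarrow> 0 * (\<bar>u\<bar> + \<bar>v0\<bar>)"
    by (intro tendsto_intros saddle_tendsto_0 v)
  then have small: "\<forall>\<^sub>F n in sequentially. saddle n * (\<bar>u\<bar> + \<bar>v n\<bar>) < 1/2"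
    by (intro order_tendstoD) auto
  have "R \<longlonglongrightarrow> 0"
  proof (rule Lim_null_comparison)
    \<comment> \<open>Cubed phases give \<open>saddle n ^ 6\<close>, and the \<open>m\<close> cells
      of an antidiagonal raise \<open>m ^ 3\<close> to \<open>m ^ 4\<close>. The Riemann scaling
      needs only the fifth power, so the error vanishes.\<close>
    let ?S = "\<lambda>j n. saddle n ^ (4 + 2) * (\<Sum>m=1..n. real m ^ 4 * bose (saddle n * real m) ^ j)"
    show "\<forall>\<^sub>F n in sequentially. norm (R n) \<le> 2 * (\<bar>u\<bar> + \<bar>v n\<bar>) ^ 3 * (?S 1 n + ?S 2 n + ?S 3 n)"
      using small
    proof eventually_elim
      case (elim n)
      \<comment> \<open>The absolute values make \<open>?g\<close> nonnegative on all reals, as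
        \<open>sum_triangle_cubic_le\<close> asks; hook lengths are positive and unaffected.\<close>
      let ?g = "\<lambda>h. 2 * (bose (saddle n * \<bar>h\<bar>) + (bose (saddle n * \<bar>h\<bar>))\<^sup>2 + bose (saddle n * \<bar>h\<bar>) ^ 3)"
      have g0: "0 \<le> ?g h" for h
      proof (cases "h = 0")
        case False
        then have "0 < bose (saddle n * \<bar>h\<bar>)" using saddle_props(1)[of n] by (intro bose_pos) simp
        then show ?thesis by simp
      qed (simp add: bose_def)
      have "norm (R n) \<le> (\<Sum>x\<in>triangle n. 2 * (b n x + (b n x)\<^sup>2 + b n x ^ 3) * \<bar>t n x\<bar> ^ 3)"
        unfolding R_def L_def
        by (intro order.trans[OF norm_sum] sum_mono ln_geometric_factor b0 order.trans[OF bt]) (use elim in simp)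
      also have "\<dots> = (\<Sum>x\<in>triangle n. ?g (hook x) * \<bar>u * saddle n ^ 2 * hook x + v n * saddle n ^ 2 * skew x\<bar> ^ 3)"
        unfolding b_def t_def by (intro sum.cong refl) (simp add: abs_of_pos)
      also have "\<dots> \<le> (\<bar>u * saddle n ^ 2\<bar> + \<bar>v n * saddle n ^ 2\<bar>) ^ 3 * (\<Sum>m=1..n. real m ^ 4 * ?g (real m))"
        by (rule sum_triangle_cubic_le[OF g0])
      also have "(\<bar>u * saddle n ^ 2\<bar> + \<bar>v n * saddle n ^ 2\<bar>) ^ 3 = (\<bar>u\<bar> + \<bar>v n\<bar>) ^ 3 * saddle n ^ 6"
      proof -
        have "\<bar>u * saddle n ^ 2\<bar> + \<bar>v n * saddle n ^ 2\<bar> = (\<bar>u\<bar> + \<bar>v n\<bar>) * saddle n ^ 2"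
          by (simp add: abs_mult algebra_simps)
        then show ?thesis by (simp add: power_mult_distrib flip: power_mult)
      qed
      also have "(\<Sum>m=1..n. real m ^ 4 * ?g (real m)) = 2 * ((\<Sum>m=1..n. real m ^ 4 * bose (saddle n * real m) ^ 1) + (\<Sum>m=1..n. real m ^ 4 * bose (saddle n * real m) ^ 2) + (\<Sum>m=1..n. real m ^ 4 * bose (saddle n * real m) ^ 3))"
        by (simp add: sum_distrib_left sum.distrib[symmetric] algebra_simps)
      finally show ?case by (simp add: algebra_simps)
    qed
    have "(\<lambda>n. 2 * (\<bar>u\<bar> + \<bar>v n\<bar>) ^ 3 * (?S 1 n + ?S 2 n + ?S 3 n)) \<longlonglongrightarrow> 2 * (\<bar>u\<bar> + \<bar>v0\<bar>) ^ 3 * (0 + 0 + 0)"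
      by (intro tendsto_intros v saddle_moment_tendsto_0) auto
    then show "(\<lambda>n. 2 * (\<bar>u\<bar> + \<bar>v n\<bar>) ^ 3 * (?S 1 n + ?S 2 n + ?S 3 n)) \<longlonglongrightarrow> 0" by simp
  qed
  moreover have "Q \<longlonglongrightarrow> 6 * zeta3 * (u\<^sup>2 + v0\<^sup>2 / 3)"
  proof -
    have "Q = (\<lambda>n. (u\<^sup>2 + (v n)\<^sup>2 / 3) * V n - (v n)\<^sup>2 / 3 * W n)"
      unfolding Q_def[abs_def] b_def t_def V_def W_def
      by (rule ext, subst sum_triangle_quadratic[where g = "\<lambda>h. bose (saddle n * h) + (bose (saddle n * h))\<^sup>2"])
         (simp add: power_mult_distrib algebra_simps flip: power_mult)
    moreover have "(\<lambda>n. (u\<^sup>2 + (v n)\<^sup>2 / 3) * V n - (v n)\<^sup>2 / 3 * W n) \<longlonglongrightarrow> (u\<^sup>2 + v0\<^sup>2 / 3) * (6 * zeta3) - v0\<^sup>2 / 3 * 0"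
      unfolding V_def W_def by (intro tendsto_intros v saddle_variance_limit saddle_second_order_tendsto_0) auto
    ultimately show ?thesis by (simp only: mult_zero_right mult_zero_left diff_zero mult.commute)
  qed
  ultimately have "(\<lambda>n. exp (R n - of_real (Q n / 2))) \<longlonglongrightarrow> exp (0 - of_real (6 * zeta3 * (u\<^sup>2 + v0\<^sup>2 / 3) / 2))"
    by (intro tendsto_intros) auto
  moreover have "\<forall>\<^sub>F n in sequentially. exp (R n - of_real (Q n / 2)) = rescaled_cf n (v n) u"
    using small eventually_gt_at_top[of 0]
  proof eventually_elim
    case (elim n)
    have ne: "1 - of_real (b n x) * (cis (t n x) - 1) \<noteq> 0" for x
    proof
      assume "1 - of_real (b n x) * (cis (t n x) - 1) = 0"
      then have "norm (of_real (b n x) * (cis (t n x) - 1)) = 1" by (metis eq_iff_diff_eq_0 norm_one)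
      moreover have "norm (of_real (b n x) * (cis (t n x) - 1)) \<le> b n x * \<bar>t n x\<bar>"
        unfolding norm_mult using b0[of n x] by (intro mult_mono cis_taylor) auto
      ultimately show False using bt[of n x] elim by simp
    qed
    have "boltzmann_cf n (saddle n) (v n * saddle n ^ 2) (u * saddle n ^ 2) = (\<Prod>x\<in>triangle n. 1 / (1 - of_real (b n x) * (cis (t n x) - 1)))"
      unfolding boltzmann_cf_def b_def t_def by (intro prod.cong refl geometric_factor_eq saddle_props)
    also have "\<dots> = (\<Prod>x\<in>triangle n. exp (L n x))"
      unfolding L_def using ne by (intro prod.cong refl) (simp add: exp_minus inverse_eq_divide)
    also have "\<dots> = exp (\<Sum>x\<in>triangle n. L n x)" by (simp add: exp_sum)
    also have "(\<Sum>x\<in>triangle n. L n x) = R n + \<i> * of_real (\<Sum>x\<in>triangle n. b n x * t n x) - of_real (Q n / 2)"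
      unfolding R_def Q_def by (simp add: sum_subtractf sum_distrib_left sum_divide_distrib)
    \<comment> \<open>Here the saddle equation enters as an exact identity; an asymptotic one would
      leave a phase error multiplied by \<open>n\<close>.\<close>
    also have "(\<Sum>x\<in>triangle n. b n x * t n x) = u * saddle n ^ 2 * real n"
      unfolding b_def t_def using sum_triangle_linear[of "\<lambda>h. bose (saddle n * h)"] saddle_props(2) elim by simp
    finally have "rescaled_cf n (v n) u = exp (R n + \<i> * of_real (u * saddle n ^ 2 * real n) - of_real (Q n / 2)) * exp (\<i> * of_real (- real n * (u * saddle n ^ 2)))"
      by (simp add: rescaled_cf_def cis_conv_exp)
    also have "\<dots> = exp (R n - of_real (Q n / 2))"
      unfolding exp_add[symmetric] by (rule arg_cong[of _ _ exp]) (simp add: algebra_simps)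
    finally show ?case ..
  qed
  ultimately have "(\<lambda>n. rescaled_cf n (v n) u) \<longlonglongrightarrow> exp (0 - of_real (6 * zeta3 * (u\<^sup>2 + v0\<^sup>2 / 3) / 2))"
    by (rule Lim_transform_eventually)
  then show ?thesis by (simp add: exp_of_real[symmetric] mult.assoc)
qed

subsection \<open>The integrand away from the saddle point\<close>

lemma one_minus_cos_eq: "1 - cos (y :: real) = 2 * (sin (y / 2))\<^sup>2"
  using cos_double_sin[of "y / 2"] by simp

text \<open>Up to a factor 2, \<open>1 - cos x\<close> is the squared chord from 1 to
  \<open>cis x\<close>; this is the triangle inequality for chords, squared.\<close>

lemma one_minus_cos_add_le:
  fixes x y :: real
  shows "1 - cos x \<le> 2 * (1 - cos (x + y)) + 2 * (1 - cos y)"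
proof -
  define a b where "a = sin ((x + y) / 2)" and "b = sin (y / 2)"
  have "\<bar>sin (x / 2)\<bar> \<le> \<bar>a\<bar> + \<bar>b\<bar>"
  proof -
    have "sin (x / 2) = a * cos (y / 2) - cos ((x + y) / 2) * b"
      unfolding a_def b_def sin_diff[symmetric] by (simp add: field_simps)
    then have "\<bar>sin (x / 2)\<bar> \<le> \<bar>a\<bar> * \<bar>cos (y / 2)\<bar> + \<bar>cos ((x + y) / 2)\<bar> * \<bar>b\<bar>"
      using abs_triangle_ineq4[of "a * cos (y / 2)" "cos ((x + y) / 2) * b"] by (simp add: abs_mult)
    also have "\<dots> \<le> \<bar>a\<bar> * 1 + 1 * \<bar>b\<bar>"
      by (intro add_mono mult_mono) auto
    finally show ?thesis by simp
  qed
  then have "\<bar>sin (x / 2)\<bar>\<^sup>2 \<le> (\<bar>a\<bar> + \<bar>b\<bar>)\<^sup>2" by (intro power_mono) auto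
  also have "\<dots> \<le> 2 * a\<^sup>2 + 2 * b\<^sup>2"
    using sum_squares_bound[of "\<bar>a\<bar>" "\<bar>b\<bar>"] by (simp add: power2_sum)
  finally show ?thesis unfolding one_minus_cos_eq a_def b_def by simp
qed

lemma one_minus_cos_le: "1 - cos (y :: real) \<le> y\<^sup>2 / 2"
proof -
  have "\<bar>sin (y / 2)\<bar>\<^sup>2 \<le> \<bar>y / 2\<bar>\<^sup>2" by (intro power_mono abs_sin_x_le_abs_x) auto
  then show ?thesis unfolding one_minus_cos_eq by (simp add: power_divide)
qed

lemma one_minus_cos_ge:
  assumes "\<bar>y\<bar> \<le> pi"
  shows "y\<^sup>2 / 8 \<le> 1 - cos (y :: real)"
proof -
  define t where "t = \<bar>y\<bar> / 2"
  \<comment> \<open>The bound 1.6 exceeds pi / 2 while its square stays below 3, which gives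
    \<open>t ^ 3 / 6 \<le> t / 2\<close> and thus \<open>sin t \<ge> t / 2\<close>.\<close>
  have t: "0 \<le> t" "t \<le> 1.6" using assms pi_less_4 pi_approx by (auto simp: t_def)
  have "\<bar>Im (cis t - 1 - \<i> * t + t\<^sup>2 / 2)\<bar> \<le> \<bar>t\<bar> ^ 3 / 6"
    by (rule order.trans[OF abs_Im_le_cmod cis_taylor(3)])
  moreover have "Im (cis t - 1 - \<i> * t + t\<^sup>2 / 2) = sin t - t" by (simp add: power2_eq_square)
  ultimately have "\<bar>sin t - t\<bar> \<le> t ^ 3 / 6" using t by simp
  then have "t - t ^ 3 / 6 \<le> sin t" by linarith
  moreover have "t ^ 3 / 6 \<le> t / 2"
  proof -
    have "t * t\<^sup>2 \<le> t * 3"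
      using power_mono[OF t(2) t(1), of 2] t by (intro mult_left_mono) (auto simp: power2_eq_square)
    then show ?thesis by (simp add: power3_eq_cube power2_eq_square)
  qed
  ultimately have "t / 2 \<le> sin t" by linarith
  then have "(t / 2)\<^sup>2 \<le> (sin t)\<^sup>2" using t by (intro power_mono) auto
  moreover have "1 - cos y = 2 * (sin t)\<^sup>2"
    unfolding one_minus_cos_eq t_def by (cases "y \<ge> 0") auto
  ultimately show ?thesis by (simp add: t_def power_divide)
qed

text \<open>If \<open>\<alpha>\<close> is not small compared with \<open>1 / M\<close>, some \<open>j \<le> M\<close> has \<open>cos (\<alpha> j) \<le> 0\<close>, and then
  \<open>1 - cos (\<alpha> m)\<close> and \<open>1 - cos (\<alpha> (m + j))\<close> cannot both be small.\<close>

lemma sum_one_minus_cos_ge: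
  fixes \<alpha> :: real
  assumes M: "1 \<le> M" and \<alpha>: "\<bar>\<alpha>\<bar> \<le> pi"
  shows "real M / 8 * min 1 ((real M * \<alpha>)\<^sup>2) \<le> (\<Sum>m=M..<4 * M. 1 - cos (\<alpha> * real m))"
proof -
  define S where "S = (\<Sum>m=M..<4 * M. 1 - cos (\<alpha> * real m))"
  have part: "(\<Sum>m\<in>A. 1 - cos (\<alpha> * real m)) \<le> S" if "A \<subseteq> {M..<4 * M}" for A
    unfolding S_def using that by (intro sum_mono2) auto
  show ?thesis
  proof (cases "\<bar>\<alpha>\<bar> * (2 * real M) < pi")
    case True
    have "real M * ((real M * \<alpha>)\<^sup>2 / 8) = (\<Sum>m=M..<2 * M. (real M * \<alpha>)\<^sup>2 / 8)" by simp
    also have "\<dots> \<le> (\<Sum>m=M..<2 * M. 1 - cos (\<alpha> * real m))"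
    proof (intro sum_mono)
      fix m assume m: "m \<in> {M..<2 * M}"
      have "\<bar>\<alpha> * real m\<bar> \<le> \<bar>\<alpha>\<bar> * (2 * real M)"
        using m by (simp add: abs_mult mult_left_mono)
      then have "(\<alpha> * real m)\<^sup>2 / 8 \<le> 1 - cos (\<alpha> * real m)"
        using True by (intro one_minus_cos_ge) linarith
      moreover have "(real M * \<alpha>)\<^sup>2 \<le> (\<alpha> * real m)\<^sup>2"
        using m by (simp add: power_mult_distrib mult.commute mult_left_mono power_mono)
      ultimately show "(real M * \<alpha>)\<^sup>2 / 8 \<le> 1 - cos (\<alpha> * real m)" by linarith
    qed
    also have "\<dots> \<le> S" by (rule part) auto
    finally have "real M / 8 * (real M * \<alpha>)\<^sup>2 \<le> S" by simp
    moreover have "real M / 8 * min 1 ((real M * \<alpha>)\<^sup>2) \<le> real M / 8 * (real M * \<alpha>)\<^sup>2"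
      by (intro mult_left_mono) auto
    ultimately show ?thesis unfolding S_def by linarith
  next
    case False
    then have \<alpha>0: "0 < \<bar>\<alpha>\<bar>" using pi_gt_zero by (cases "\<alpha> = 0") auto
    \<comment> \<open>The least \<open>j\<close> with
      \<open>\<bar>\<alpha>\<bar> * j \<ge> pi / 2\<close>. It overshoots by at most
      \<open>\<bar>\<alpha>\<bar> \<le> pi\<close>, so the angle stays within the arc from pi / 2 to
      3 pi / 2, where the cosine is not positive.\<close>
    define j where "j = nat \<lceil>pi / (2 * \<bar>\<alpha>\<bar>)\<rceil>"
    have jc: "real j = of_int \<lceil>pi / (2 * \<bar>\<alpha>\<bar>)\<rceil>"
    proof -
      have "0 \<le> pi / (2 * \<bar>\<alpha>\<bar>)" by simp
      then have "0 \<le> \<lceil>pi / (2 * \<bar>\<alpha>\<bar>)\<rceil>" by linarith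
      then show ?thesis by (simp add: j_def)
    qed
    have j1: "pi / (2 * \<bar>\<alpha>\<bar>) \<le> real j" "real j < pi / (2 * \<bar>\<alpha>\<bar>) + 1"
      unfolding jc by linarith+
    have "pi / (2 * \<bar>\<alpha>\<bar>) \<le> real M" using False \<alpha>0 by (simp add: field_simps)
    then have jM: "j \<le> M" 
      using \<alpha>0 by (simp add: j_def nat_le_iff ceiling_le_iff)
    have "pi / 2 \<le> \<bar>\<alpha>\<bar> * real j" "\<bar>\<alpha>\<bar> * real j \<le> pi / 2 + \<bar>\<alpha>\<bar>"
      using j1 \<alpha>0 by (simp_all add: field_simps)
    then have "cos (\<bar>\<alpha>\<bar> * real j) \<le> 0"
      using cos_ge_zero[of "\<bar>\<alpha>\<bar> * real j - pi"] \<alpha> by (simp add: cos_diff)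
    then have c: "1 \<le> 1 - cos (\<alpha> * real j)" by (cases "\<alpha> \<ge> 0") auto
    have "real M = (\<Sum>m=M..<2 * M. 1)" by simp
    also have "\<dots> \<le> (\<Sum>m=M..<2 * M. 2 * (1 - cos (\<alpha> * real (m + j))) + 2 * (1 - cos (\<alpha> * real m)))"
    proof (intro sum_mono)
      fix m
      show "1 \<le> 2 * (1 - cos (\<alpha> * real (m + j))) + 2 * (1 - cos (\<alpha> * real m))"
        using one_minus_cos_add_le[of "\<alpha> * real j" "\<alpha> * real m"] c by (simp add: algebra_simps)
    qed
    also have "\<dots> = 2 * (\<Sum>m=M..<2 * M. 1 - cos (\<alpha> * real (m + j))) + 2 * (\<Sum>m=M..<2 * M. 1 - cos (\<alpha> * real m))"
      by (simp only: sum.distrib sum_distrib_left)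
    also have "(\<Sum>m=M..<2 * M. 1 - cos (\<alpha> * real (m + j))) = (\<Sum>m=M + j..<2 * M + j. 1 - cos (\<alpha> * real m))"
      by (rule sum.shift_bounds_nat_ivl[symmetric])
    also have "\<dots> \<le> S" using jM by (intro part) auto
    also have "(\<Sum>m=M..<2 * M. 1 - cos (\<alpha> * real m)) \<le> S" by (rule part) auto
    finally have "real M / 4 \<le> S" by simp
    moreover have "real M / 8 * min 1 ((real M * \<alpha>)\<^sup>2) \<le> real M / 8 * 1"
      by (intro mult_left_mono) auto
    ultimately show ?thesis unfolding S_def by linarith
  qed
qed

section \<open>Decay of a single factor and of the product\<close>

lemma norm_one_minus_mult_cis:
  "(norm (1 - of_real b * (cis t - 1)))\<^sup>2 = 1 + 2 * (b + b\<^sup>2) * (1 - cos t)"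
proof -
  have "(norm (1 - of_real b * (cis t - 1)))\<^sup>2 = (1 - b * (cos t - 1))\<^sup>2 + (b * sin t)\<^sup>2"
    by (simp add: cmod_power2)
  also have "\<dots> = 1 + 2 * b * (1 - cos t) + b\<^sup>2 * ((sin t)\<^sup>2 + (cos t)\<^sup>2 + 1 - 2 * cos t)"
  proof -
    have "(1 - b * (x - 1))\<^sup>2 + (b * y)\<^sup>2 = 1 + 2 * b * (1 - x) + b\<^sup>2 * (y\<^sup>2 + x\<^sup>2 + 1 - 2 * x)" for x y :: real
      by (simp add: power2_eq_square algebra_simps)
    then show ?thesis .
  qed
  also have "\<dots> = 1 + 2 * (b + b\<^sup>2) * (1 - cos t)"
    by (simp only: sin_cos_squared_add) (simp add: algebra_simps)
  finally show ?thesis .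
qed

lemma norm_geometric_factor_le_1:
  assumes "0 \<le> b"
  shows "norm (1 / (1 - of_real b * (cis t - 1))) \<le> 1"
proof -
  have "1 \<le> (norm (1 - of_real b * (cis t - 1)))\<^sup>2"
    unfolding norm_one_minus_mult_cis using assms by simp
  then have "1 \<le> norm (1 - of_real b * (cis t - 1))"
    by (metis abs_norm_cancel abs_one one_power2 power2_le_iff_abs_le norm_ge_zero abs_le_square_iff)
  then show ?thesis by (simp add: norm_divide divide_le_eq_1)
qed

text \<open>The squared modulus of the denominator increases with \<open>b\<close>, so a lower bound
  \<open>b0\<close> suffices. For \<open>b0 \<le> 1/4\<close> the quantity \<open>y\<close> is at
  most 1, where \<open>exp (y / 2) \<le> 1 + y\<close>.\<close>

lemma norm_geometric_factor_le_exp: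
  assumes "b0 \<le> b" "0 \<le> b0" "b0 \<le> 1/4"
  shows "norm (1 / (1 - of_real b * (cis t - 1))) \<le> exp (- (b0 / 2 * (1 - cos t)))"
proof -
  define y where "y = 2 * b0 * (1 - cos t)"
  have y: "0 \<le> y" unfolding y_def using assms by simp
  have "y \<le> 2 * (1/4) * 2" unfolding y_def using assms cos_ge_minus_one[of t] by (intro mult_mono) auto
  then have y1: "y / 2 \<le> 1" by simp
  have "exp (y / 2) \<le> 1 + y / 2 + (y / 2)\<^sup>2" using y y1 by (intro exp_bound) auto
  also have "\<dots> \<le> 1 + y"
    using y y1 mult_left_mono[OF y1, of "y / 2"] by (simp add: power2_eq_square)
  also have "\<dots> \<le> 1 + 2 * (b + b\<^sup>2) * (1 - cos t)"
  proof -
    have "b0 \<le> b + b\<^sup>2" using assms(1) by (intro add_increasing2) auto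
    then have "2 * b0 \<le> 2 * (b + b\<^sup>2)" by simp
    then have "2 * b0 * (1 - cos t) \<le> 2 * (b + b\<^sup>2) * (1 - cos t)" by (rule mult_right_mono) simp
    then show ?thesis unfolding y_def by simp
  qed
  also have "\<dots> = (norm (1 - of_real b * (cis t - 1)))\<^sup>2"
    by (rule norm_one_minus_mult_cis[symmetric])
  finally have "(exp (y / 4))\<^sup>2 \<le> (norm (1 - of_real b * (cis t - 1)))\<^sup>2"
    by (simp add: power2_eq_square flip: exp_add)
  then have "exp (y / 4) \<le> norm (1 - of_real b * (cis t - 1))"
    by (rule power2_le_imp_le) simp
  then have "norm (1 / (1 - of_real b * (cis t - 1))) \<le> 1 / exp (y / 4)"
    unfolding norm_divide norm_one by (intro frac_le) auto
  also have "\<dots> = exp (- (b0 / 2 * (1 - cos t)))"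
    by (simp add: y_def exp_minus inverse_eq_divide)
  finally show ?thesis .
qed

text \<open>Only the cells with hook length comparable to \<open>1 / \<tau>\<close> are used; for them the geometric parameter
  stays away from 0 and 1.\<close>

lemma norm_boltzmann_cf_le:
  fixes M :: nat
  assumes \<tau>: "0 < \<tau>" "\<tau> \<le> 1" and M: "1 \<le> \<tau> * real M" "\<tau> * real M \<le> 2" "4 * M \<le> n"
    and \<alpha>: "\<bar>\<alpha>\<bar> \<le> pi"
  shows "norm (boltzmann_cf n \<tau> \<theta> \<alpha>) \<le>
     exp (- (bose 8 / 2 * (real M ^ 2 / 16 * min 1 ((real M * \<alpha>)\<^sup>2) - 96 * real M ^ 4 * \<theta>\<^sup>2)))"
proof -
  let ?A = "{x \<in> triangle n. hook x \<in> {real M..<4 * real M}}"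
  define t where "t x = \<alpha> * hook x + \<theta> * skew x" for x
  have M1: "1 \<le> M" using M(1) by (cases M) auto
  have b8: "0 \<le> bose 8" "bose 8 \<le> 1/4" using bose_pos[of 8] bose_le(2)[of 8] by auto
  have b0: "0 \<le> bose (\<tau> * hook x)" for x using \<tau> by (intro less_imp_le[OF bose_pos]) simp
  have "norm (boltzmann_cf n \<tau> \<theta> \<alpha>) = (\<Prod>x\<in>triangle n. norm (1 / (1 - of_real (bose (\<tau> * hook x)) * (cis (t x) - 1))))"
    unfolding boltzmann_cf_def t_def by (subst prod_norm[symmetric]) (intro prod.cong refl arg_cong[of _ _ norm] geometric_factor_eq \<tau>)
  also have "\<dots> \<le> (\<Prod>x\<in>triangle n. if x \<in> ?A then exp (- (bose 8 / 2 * (1 - cos (t x)))) else 1)"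
  proof (intro prod_mono conjI norm_ge_zero)
    fix x
    show "norm (1 / (1 - of_real (bose (\<tau> * hook x)) * (cis (t x) - 1))) \<le> (if x \<in> ?A then exp (- (bose 8 / 2 * (1 - cos (t x)))) else 1)"
    proof (cases "x \<in> ?A")
      case True
      \<comment> \<open>Origin of \<open>bose 8\<close>: hook lengths below \<open>4 * M\<close>
        with \<open>\<tau> * M \<le> 2\<close> keep the argument at most 8.\<close>
      then have "\<tau> * hook x \<le> \<tau> * (4 * real M)" using \<tau> by (intro mult_left_mono) auto
      then have "\<tau> * hook x \<le> 8" using M by simp
      then have "bose 8 \<le> bose (\<tau> * hook x)" using \<tau> by (intro bose_antimono) auto
      then show ?thesis using True norm_geometric_factor_le_exp b8 by simp
    qed (simp only: if_False norm_geometric_factor_le_1[OF b0])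
  qed
  also have "\<dots> = (\<Prod>x\<in>?A. exp (- (bose 8 / 2 * (1 - cos (t x)))))"
    by (rule prod.mono_neutral_cong_right) auto
  also have "\<dots> = exp (- (bose 8 / 2 * (\<Sum>x\<in>?A. 1 - cos (t x))))"
    by (simp only: exp_sum[symmetric] finite_subset[OF _ finite_triangle] sum_negf sum_distrib_left Collect_restrict)
       (simp add: exp_sum[symmetric] sum_negf sum_distrib_left)
  also have "\<dots> \<le> exp (- (bose 8 / 2 * (real M ^ 2 / 16 * min 1 ((real M * \<alpha>)\<^sup>2) - 96 * real M ^ 4 * \<theta>\<^sup>2)))"
  proof -
    have "(\<Sum>x\<in>?A. 1 - cos (t x)) = (\<Sum>x\<in>triangle n. if hook x \<in> {real M..<4 * real M} then 1 - cos (t x) else 0)"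
      by (rule sum.mono_neutral_cong_left) auto
    also have "\<dots> = (\<Sum>m=1..n. if m \<in> {M..<4 * M} then \<Sum>a<m. 1 - cos (t (a, m - Suc a)) else 0)"
      unfolding sum_triangle
    proof (rule sum.cong[OF refl])
      fix m
      have "(real M \<le> real m \<and> real m < 4 * real M) = (M \<le> m \<and> m < 4 * M)"
        by (metis of_nat_le_iff of_nat_less_iff of_nat_mult of_nat_numeral)
      then show "(\<Sum>a<m. if hook (a, m - Suc a) \<in> {real M..<4 * real M} then 1 - cos (t (a, m - Suc a)) else 0)
        = (if m \<in> {M..<4 * M} then \<Sum>a<m. 1 - cos (t (a, m - Suc a)) else 0)"
        by (cases "M \<le> m \<and> m < 4 * M") (auto simp: hook_antidiagonal intro!: sum.neutral sum.cong)
    qed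
    also have "\<dots> = (\<Sum>m=M..<4 * M. \<Sum>a<m. 1 - cos (t (a, m - Suc a)))"
      using M1 M(3) by (intro sum.mono_neutral_cong_right) auto
    \<comment> \<open>\<open>one_minus_cos_add_le\<close> splits off the part of the phase
      containing \<open>\<theta>\<close>. An antidiagonal loses at most
      \<open>m ^ 3 * \<theta>\<^sup>2 / 2\<close>, which for \<open>m < 4 * M\<close> is at most
      \<open>32 * M ^ 3 * \<theta>\<^sup>2\<close>; the \<open>3 * M\<close> antidiagonals together
      lose \<open>96 * M ^ 4 * \<theta>\<^sup>2\<close>.\<close>
    also have "\<dots> \<ge> (\<Sum>m=M..<4 * M. real M / 2 * (1 - cos (\<alpha> * real m)) - 32 * real M ^ 3 * \<theta>\<^sup>2)"
    proof (intro sum_mono)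
      fix m assume m: "m \<in> {M..<4 * M}"
      have "real m * ((1 - cos (\<alpha> * real m)) / 2 - (real m)\<^sup>2 * \<theta>\<^sup>2 / 2) = (\<Sum>a<m. (1 - cos (\<alpha> * real m)) / 2 - (real m)\<^sup>2 * \<theta>\<^sup>2 / 2)"
        by simp
      also have "\<dots> \<le> (\<Sum>a<m. 1 - cos (t (a, m - Suc a)))"
      proof (intro sum_mono)
        fix a assume "a \<in> {..<m}"
        then have a: "a < m" by simp
        let ?s = "\<theta> * skew (a, m - Suc a)"
        have te: "t (a, m - Suc a) = \<alpha> * real m + ?s" by (simp add: t_def hook_antidiagonal[OF a])
        have "1 - cos ?s \<le> ?s\<^sup>2 / 2" by (rule one_minus_cos_le)
        also have "?s\<^sup>2 = \<bar>skew (a, m - Suc a)\<bar>\<^sup>2 * \<theta>\<^sup>2" by (simp add: power_mult_distrib)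
        also have "\<dots> \<le> (real m)\<^sup>2 * \<theta>\<^sup>2"
          using abs_skew_le[of "(a, m - Suc a)"] by (intro mult_right_mono power_mono) (auto simp: hook_antidiagonal[OF a])
        finally have "1 - cos ?s \<le> (real m)\<^sup>2 * \<theta>\<^sup>2 / 2" by simp
        moreover have "p / 2 - w / 2 \<le> q" if "p \<le> 2 * q + 2 * r" "r \<le> w / 2" for p q r w :: real
          using that by linarith
        ultimately show "(1 - cos (\<alpha> * real m)) / 2 - (real m)\<^sup>2 * \<theta>\<^sup>2 / 2 \<le> 1 - cos (t (a, m - Suc a))"
          unfolding te using one_minus_cos_add_le[of "\<alpha> * real m" ?s] by blast
      qed
      finally have *: "real m / 2 * (1 - cos (\<alpha> * real m)) - real m ^ 3 * \<theta>\<^sup>2 / 2 \<le> (\<Sum>a<m. 1 - cos (t (a, m - Suc a)))"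
        by (simp add: algebra_simps power2_eq_square power3_eq_cube)
      have "real M / 2 * (1 - cos (\<alpha> * real m)) \<le> real m / 2 * (1 - cos (\<alpha> * real m))"
        using m by (intro mult_right_mono) auto
      moreover have "real m ^ 3 * \<theta>\<^sup>2 \<le> (4 * real M) ^ 3 * \<theta>\<^sup>2"
        using m by (intro mult_right_mono power_mono) auto
      ultimately show "real M / 2 * (1 - cos (\<alpha> * real m)) - 32 * real M ^ 3 * \<theta>\<^sup>2 \<le> (\<Sum>a<m. 1 - cos (t (a, m - Suc a)))"
        using * by (simp add: power_mult_distrib)
    qed
    also have "(\<Sum>m=M..<4 * M. real M / 2 * (1 - cos (\<alpha> * real m)) - 32 * real M ^ 3 * \<theta>\<^sup>2)
       = real M / 2 * (\<Sum>m=M..<4 * M. 1 - cos (\<alpha> * real m)) - 96 * real M ^ 4 * \<theta>\<^sup>2"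
      by (simp only: sum_subtractf sum_distrib_left[symmetric] sum_constant card_atLeastLessThan) (simp add: power_numeral_reduce of_nat_diff)
    finally have "real M / 2 * (\<Sum>m=M..<4 * M. 1 - cos (\<alpha> * real m)) - 96 * real M ^ 4 * \<theta>\<^sup>2 \<le> (\<Sum>x\<in>?A. 1 - cos (t x))" .
    moreover have "real M / 2 * (real M / 8 * min 1 ((real M * \<alpha>)\<^sup>2)) \<le> real M / 2 * (\<Sum>m=M..<4 * M. 1 - cos (\<alpha> * real m))"
      by (intro mult_left_mono sum_one_minus_cos_ge M1 \<alpha>) simp
    ultimately have "real M ^ 2 / 16 * min 1 ((real M * \<alpha>)\<^sup>2) - 96 * real M ^ 4 * \<theta>\<^sup>2 \<le> (\<Sum>x\<in>?A. 1 - cos (t x))"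
      by (simp add: power2_eq_square)
    then show ?thesis using b8 by (simp add: mult_left_mono)
  qed
  finally show ?thesis .
qed

subsection \<open>The limit law\<close>

text \<open>The indicator carries the growing integration range, so that all integrals run over the
  whole line and dominated convergence applies.\<close>

definition windowed_cf :: "nat \<Rightarrow> real \<Rightarrow> real \<Rightarrow> complex" where
  "windowed_cf n v u = indicator {-pi..pi} (u * saddle n ^ 2) *\<^sub>R rescaled_cf n v u"

lemma borel_measurable_windowed_cf [measurable]: "windowed_cf n v \<in> borel_measurable borel"
  unfolding windowed_cf_def[abs_def] rescaled_cf_def by measurable

lemma norm_rescaled_cf_le:
  assumes n: "saddle n \<le> 1" "8 \<le> real n * saddle n" and v: "\<bar>v\<bar> \<le> B" and u: "\<bar>u * saddle n ^ 2\<bar> \<le> pi"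
  shows "norm (rescaled_cf n v u) \<le> exp (bose 8 / 2 * (1 / 16 + 1536 * B\<^sup>2)) * exp (- (bose 8 / 128) * \<bar>u\<bar>)"
proof -
  define s where "s = saddle n"
  have s: "0 < s" "s \<le> 1" using saddle_props(1)[of n] n by (auto simp: s_def)
  \<comment> \<open>This puts \<open>s * M\<close> between 1 and 2, and the assumption
    \<open>8 \<le> n * s\<close> then yields \<open>4 * M \<le> n\<close>.\<close>
  define M where "M = nat \<lceil>1 / s\<rceil>"
  have "0 < 1 / s" using s by simp
  then have Mc: "real M = of_int \<lceil>1 / s\<rceil>" by (simp add: M_def)
  have "1 / s \<le> real M" "real M \<le> 1 / s + 1" unfolding Mc by linarith+
  then have M1: "1 \<le> s * real M" and M2': "s * real M \<le> 1 + s" using s by (simp_all add: field_simps)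
  then have M2: "s * real M \<le> 2" using s by linarith
  have "s * real (4 * M) = 4 * (s * real M)" by simp
  also have "\<dots> \<le> real n * s" using M2 n(2)[folded s_def] by linarith
  finally have "s * real (4 * M) \<le> s * real n" by (simp only: mult.commute)
  then have Mn: "4 * M \<le> n" using s(1) by (simp del: of_nat_mult)
  have b8: "0 < bose 8" by (rule bose_pos) simp
  have Msq: "1 \<le> s\<^sup>2 * real M ^ 2"
    using power_mono[OF M1, of 2] by (simp add: power_mult_distrib)
  \<comment> \<open>If the minimum is the square, the product is at least \<open>u\<^sup>2\<close>.
    Otherwise it is \<open>M ^ 2\<close>, which dominates \<open>\<bar>u\<bar> / 4\<close> only
    because \<open>\<bar>u\<bar> * s\<^sup>2 \<le> pi < 4\<close>. The linear bound serves both
    cases.\<close>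
  have main: "\<bar>u\<bar> / 4 - 1 \<le> real M ^ 2 * min 1 ((real M * (u * s\<^sup>2))\<^sup>2)"
  proof (cases "(real M * (u * s\<^sup>2))\<^sup>2 \<le> 1")
    case True
    have "u\<^sup>2 * 1 \<le> u\<^sup>2 * (s\<^sup>2 * real M ^ 2)\<^sup>2"
      using Msq by (intro mult_left_mono) auto
    also have "\<dots> = real M ^ 2 * (real M * (u * s\<^sup>2))\<^sup>2"
      by (simp add: power_mult_distrib power2_eq_square mult_ac)
    finally have "u\<^sup>2 \<le> real M ^ 2 * min 1 ((real M * (u * s\<^sup>2))\<^sup>2)" using True by simp
    moreover have "0 \<le> (\<bar>u\<bar> - 1)\<^sup>2" by simp
    then have "2 * \<bar>u\<bar> \<le> u\<^sup>2 + 1" by (simp add: power2_diff)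
    ultimately show ?thesis using abs_ge_zero[of u] by linarith
  next
    case False
    have "\<bar>u\<bar> * s\<^sup>2 \<le> 4" using u pi_less_4 by (simp add: abs_mult s_def)
    also have "4 * 1 \<le> 4 * (s\<^sup>2 * real M ^ 2)" using Msq by (intro mult_left_mono) auto
    finally have "\<bar>u\<bar> * s\<^sup>2 \<le> (4 * real M ^ 2) * s\<^sup>2" by (simp add: mult_ac)
    then have "\<bar>u\<bar> \<le> 4 * real M ^ 2" using s by simp
    then show ?thesis using False by simp
  qed
  have err: "real M ^ 4 * (v * s\<^sup>2)\<^sup>2 \<le> 16 * B\<^sup>2"
  proof -
    have "real M ^ 4 * (v * s\<^sup>2)\<^sup>2 = (s * real M) ^ 4 * \<bar>v\<bar>\<^sup>2"
      by (simp add: power_mult_distrib mult_ac flip: power_mult)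
    also have "\<dots> \<le> 2 ^ 4 * B\<^sup>2" using M2 s v by (intro mult_mono power_mono) auto
    finally show ?thesis by simp
  qed
  have "norm (rescaled_cf n v u) = norm (boltzmann_cf n s (v * s\<^sup>2) (u * s\<^sup>2))"
    by (simp add: rescaled_cf_def norm_mult s_def)
  also have "\<dots> \<le> exp (- (bose 8 / 2 * (real M ^ 2 / 16 * min 1 ((real M * (u * s\<^sup>2))\<^sup>2) - 96 * real M ^ 4 * (v * s\<^sup>2)\<^sup>2)))"
    using s M1 M2 Mn u by (intro norm_boltzmann_cf_le) (auto simp: s_def)
  also have "\<dots> \<le> exp (- (bose 8 / 2 * ((\<bar>u\<bar> / 4 - 1) / 16 - 1536 * B\<^sup>2)))"
  proof -
    have "(\<bar>u\<bar> / 4 - 1) / 16 - 1536 * B\<^sup>2 \<le> real M ^ 2 / 16 * min 1 ((real M * (u * s\<^sup>2))\<^sup>2) - 96 * real M ^ 4 * (v * s\<^sup>2)\<^sup>2"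
    proof -
      have "p / 16 - 1536 * w \<le> q / 16 * r - 96 * m * e" if "p \<le> q * r" "m * e \<le> 16 * w" for p q r m e w :: real
        using that by (simp add: algebra_simps)
      from this[OF main err] show ?thesis .
    qed
    then show ?thesis using b8 by (simp add: mult_left_mono)
  qed
  also have "\<dots> = exp (bose 8 / 2 * (1 / 16 + 1536 * B\<^sup>2)) * exp (- (bose 8 / 128) * \<bar>u\<bar>)"
    unfolding exp_add[symmetric] by (rule arg_cong[of _ _ exp]) (simp add: field_simps)
  finally show ?thesis .
qed

lemma integrable_exp_abs:
  fixes c :: real
  assumes "0 < c"
  shows "integrable lborel (\<lambda>u. exp (- c * \<bar>u\<bar>))"
proof (rule Bochner_Integration.integrable_bound)
  have e: "integrable lborel (erlang_density 0 c)"
    using nn_integral_erlang_ith_moment[OF assms, of 0 0] assms by (intro integrableI_nonneg) auto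
  then have "integrable lborel (\<lambda>u. erlang_density 0 c (0 + (-1) * u))"
    by (rule lborel_integrable_real_affine) simp
  with e show "integrable lborel (\<lambda>u. 1 / c * (erlang_density 0 c u + erlang_density 0 c (0 + (-1) * u)))"
    by (intro integrable_mult_right Bochner_Integration.integrable_add)
  show "AE u in lborel. norm (exp (- c * \<bar>u\<bar>)) \<le> norm (1 / c * (erlang_density 0 c u + erlang_density 0 c (0 + (-1) * u)))"
    using assms by (intro always_eventually allI) (auto simp: erlang_density_def)
qed simp

definition gauss_mass :: real where
  "gauss_mass = (LINT u|lborel. exp (- 3 * zeta3 * u\<^sup>2))"

text \<open>Positivity allows division in the limit, since this mass is the limit of the denominator
  in the quotient of Fourier coefficients.\<close>

lemma gauss_mass_pos: "0 < gauss_mass"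
proof -
  define \<sigma> where "\<sigma> = sqrt (1 / (6 * zeta3))"
  have \<sigma>: "0 < \<sigma>" "\<sigma>\<^sup>2 = 1 / (6 * zeta3)" using zeta3_pos by (simp_all add: \<sigma>_def)
  have "exp (- 3 * zeta3 * u\<^sup>2) = sqrt (2 * pi * \<sigma>\<^sup>2) * normal_density 0 \<sigma> u" for u
    using \<sigma> zeta3_pos pi_gt_zero by (simp add: normal_density_def)
  then have gm: "gauss_mass = sqrt (2 * pi * \<sigma>\<^sup>2)"
    unfolding gauss_mass_def using \<sigma>(1) by simp
  have "0 < 2 * pi * \<sigma>\<^sup>2" using \<sigma>(1) by simp
  then show ?thesis unfolding gm by (rule real_sqrt_gt_zero)
qed

lemma integral_windowed_cf_limit:
  assumes v: "v \<longlonglongrightarrow> v0"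
  shows "(\<lambda>n. LINT u|lborel. windowed_cf n (v n) u) \<longlonglongrightarrow> of_real (exp (- zeta3 * v0\<^sup>2) * gauss_mass)"
proof -
  obtain B where B: "\<And>n. \<bar>v n\<bar> \<le> B"
    using convergent_imp_Bseq[OF convergentI[OF v]] unfolding Bseq_def by auto
  have "\<forall>\<^sub>F n in sequentially. saddle n < 1"
    using saddle_tendsto_0 by (rule order_tendstoD) simp
  moreover have "\<forall>\<^sub>F n in sequentially. 8 \<le> real n * saddle n"
    using saddle_mult_at_top by (simp add: filterlim_at_top)
  ultimately have "\<forall>\<^sub>F n in sequentially. saddle n \<le> 1 \<and> 8 \<le> real n * saddle n"
    by eventually_elim simp
  \<comment> \<open>The majorant is available only from some index on, while dominated convergence
    asks for it at every index; hence the shift by \<open>N\<close>.\<close>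
  then obtain N where N: "\<And>n. N \<le> n \<Longrightarrow> saddle n \<le> 1 \<and> 8 \<le> real n * saddle n"
    by (auto simp: eventually_sequentially)
  let ?w = "\<lambda>u. exp (bose 8 / 2 * (1 / 16 + 1536 * B\<^sup>2)) * exp (- (bose 8 / 128) * \<bar>u\<bar>)"
  let ?f = "\<lambda>u. complex_of_real (exp (- 3 * zeta3 * (u\<^sup>2 + v0\<^sup>2 / 3)))"
  have "(\<lambda>n. LINT u|lborel. windowed_cf (n + N) (v (n + N)) u) \<longlonglongrightarrow> (LINT u|lborel. ?f u)"
  proof (rule integral_dominated_convergence[where w = ?w])
    show "windowed_cf (n + N) (v (n + N)) \<in> borel_measurable lborel" for n by simp
    show "?f \<in> borel_measurable lborel" by measurable
    show "integrable lborel ?w" using bose_pos[of 8] by (intro integrable_mult_right integrable_exp_abs) simp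
    show "AE u in lborel. (\<lambda>n. windowed_cf (n + N) (v (n + N)) u) \<longlonglongrightarrow> ?f u"
    proof (intro always_eventually allI)
      fix u :: real
      have "(\<lambda>n. \<bar>u * saddle n ^ 2\<bar>) \<longlonglongrightarrow> \<bar>u * 0 ^ 2\<bar>" by (intro tendsto_intros saddle_tendsto_0)
      then have "\<forall>\<^sub>F n in sequentially. \<bar>u * saddle n ^ 2\<bar> < pi"
        by (rule order_tendstoD) simp
      then have "\<forall>\<^sub>F n in sequentially. rescaled_cf n (v n) u = windowed_cf n (v n) u"
        by eventually_elim (auto simp: windowed_cf_def indicator_def abs_less_iff)
      with rescaled_cf_limit[OF v] have "(\<lambda>n. windowed_cf n (v n) u) \<longlonglongrightarrow> ?f u"
        by (rule Lim_transform_eventually)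
      then show "(\<lambda>n. windowed_cf (n + N) (v (n + N)) u) \<longlonglongrightarrow> ?f u" by (rule LIMSEQ_ignore_initial_segment)
    qed
    show "AE u in lborel. norm (windowed_cf (n + N) (v (n + N)) u) \<le> ?w u" for n
    proof (intro always_eventually allI)
      fix u :: real
      show "norm (windowed_cf (n + N) (v (n + N)) u) \<le> ?w u"
      proof (cases "\<bar>u * saddle (n + N) ^ 2\<bar> \<le> pi")
        case True
        have "norm (windowed_cf (n + N) (v (n + N)) u) \<le> norm (rescaled_cf (n + N) (v (n + N)) u)"
          by (simp add: windowed_cf_def indicator_def)
        also have "\<dots> \<le> ?w u" using N[of "n + N"] by (intro norm_rescaled_cf_le B True) auto
        finally show ?thesis .
      next
        case False
        then have "u * saddle (n + N) ^ 2 \<notin> {-pi..pi}" by (auto simp: abs_le_iff)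
        then show ?thesis by (simp add: windowed_cf_def)
      qed
    qed
  qed
  also have "(LINT u|lborel. ?f u) = of_real (exp (- zeta3 * v0\<^sup>2) * gauss_mass)"
  proof -
    have "(LINT u|lborel. ?f u) = of_real (LINT u|lborel. exp (- 3 * zeta3 * (u\<^sup>2 + v0\<^sup>2 / 3)))"
      by (rule integral_complex_of_real)
    also have "(LINT u|lborel. exp (- 3 * zeta3 * (u\<^sup>2 + v0\<^sup>2 / 3))) = (LINT u|lborel. exp (- zeta3 * v0\<^sup>2) * exp (- 3 * zeta3 * u\<^sup>2))"
      unfolding exp_add[symmetric]
      by (intro Bochner_Integration.integral_cong refl arg_cong[of _ _ exp]) (simp add: field_simps)
    also have "\<dots> = exp (- zeta3 * v0\<^sup>2) * gauss_mass"
      by (simp add: gauss_mass_def)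
    finally show ?thesis .
  qed
  finally show ?thesis by (rule LIMSEQ_offset)
qed

text \<open>After the substitution \<open>\<alpha> = saddle n ^ 2 * u\<close> both Fourier
  coefficients carry the same Jacobian and the same prefactor \<open>D\<close>, neither of which
  depends on \<open>v\<close>.\<close>

lemma counts_cf_ratio:
  "counts_cf n (v * saddle n ^ 2) / counts_cf n 0 =
   (LINT u|lborel. windowed_cf n v u) / (LINT u|lborel. windowed_cf n 0 u)"
proof -
  define D where "D = 2 * pi * (\<Prod>x\<in>triangle n. 1 - exp (- saddle n * hook x)) * exp (- saddle n * real n)"
  have s: "0 < saddle n" by (rule saddle_props)
  have "(\<Prod>x\<in>triangle n. 1 - exp (- saddle n * hook x)) \<noteq> 0"
    using s less_imp_neq[OF hook_pos, symmetric] by simp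
  then have D: "D \<noteq> 0" by (simp add: D_def)
  have *: "of_real (saddle n ^ 2) * (LINT u|lborel. windowed_cf n v u) = of_real D * counts_cf n (v * saddle n ^ 2)" for v
  proof -
    have "of_real D * counts_cf n (v * saddle n ^ 2) = (LINT \<alpha>:{-pi..pi}|lborel. boltzmann_cf n (saddle n) (v * saddle n ^ 2) \<alpha> * cis (- real n * \<alpha>))"
      unfolding counts_cf_integral[OF s] D_def by simp
    also have "\<dots> = \<bar>saddle n ^ 2\<bar> *\<^sub>R (LINT u|lborel. indicator {-pi..pi} (0 + saddle n ^ 2 * u) *\<^sub>R (boltzmann_cf n (saddle n) (v * saddle n ^ 2) (0 + saddle n ^ 2 * u) * cis (- real n * (0 + saddle n ^ 2 * u))))"
      unfolding set_lebesgue_integral_def by (rule lborel_integral_real_affine) (use s in simp)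
    also have "\<dots> = of_real (saddle n ^ 2) * (LINT u|lborel. windowed_cf n v u)"
      by (simp add: windowed_cf_def rescaled_cf_def scaleR_conv_of_real mult.commute)
    finally show ?thesis ..
  qed
  have "counts_cf n (v * saddle n ^ 2) = of_real (saddle n ^ 2 / D) * (LINT u|lborel. windowed_cf n v u)" for v
    using *[of v] D by (simp add: field_simps)
  from this[of v] this[of 0] show ?thesis using s D by simp
qed

lemma char_pp_diff_law_limit:
  "(\<lambda>n. char (pp_diff_law n) t) \<longlonglongrightarrow> of_real (exp (- (1 / (2 * zeta3) powr (1/3)) * t\<^sup>2 / 2))"
proof -
  define z where "z = 2 * zeta3"
  have z: "0 < z" using zeta3_pos by (simp add: z_def)
  \<comment> \<open>Chosen so that \<open>v n * saddle n ^ 2\<close> is exactly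
    \<open>t / n powr (2/3)\<close>, while \<open>n * saddle n ^ 3\<close> converges to
    \<open>z\<close>.\<close>
  define v where "v n = t / (real n * saddle n ^ 3) powr (2/3)" for n
  define v0 where "v0 = t / z powr (2/3)"
  have v: "v \<longlonglongrightarrow> v0"
    unfolding v_def v0_def using z
    by (intro tendsto_divide tendsto_powr tendsto_const saddle_mean_limit[folded z_def]) auto
  have "(\<lambda>n. (LINT u|lborel. windowed_cf n (v n) u) / (LINT u|lborel. windowed_cf n 0 u))
     \<longlonglongrightarrow> of_real (exp (- zeta3 * v0\<^sup>2) * gauss_mass) / of_real (exp (- zeta3 * 0\<^sup>2) * gauss_mass)"
    by (intro tendsto_divide integral_windowed_cf_limit v tendsto_const) (use gauss_mass_pos in simp)
  also have "of_real (exp (- zeta3 * v0\<^sup>2) * gauss_mass) / of_real (exp (- zeta3 * 0\<^sup>2) * gauss_mass) = complex_of_real (exp (- zeta3 * v0\<^sup>2))"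
    using gauss_mass_pos by simp
  also have "- zeta3 * v0\<^sup>2 = - (1 / (2 * zeta3) powr (1/3)) * t\<^sup>2 / 2"
  proof -
    \<comment> \<open>The exponent 4/3 splits as 1 + 1/3: one power of \<open>z\<close> cancels
      against \<open>2 * zeta3\<close>, and the remaining cube root is the one in the
      variance.\<close>
    have "(z powr (2/3))\<^sup>2 = z powr (1 + 1/3)"
      using z by (simp add: power2_eq_square powr_add[symmetric])
    also have "\<dots> = z * z powr (1/3)" using z by (simp only: powr_add) simp
    finally have "z * v0\<^sup>2 = t\<^sup>2 / z powr (1/3)"
      using z by (simp add: v0_def power_divide)
    then show ?thesis by (simp add: z_def)
  qed
  finally have lim: "(\<lambda>n. (LINT u|lborel. windowed_cf n (v n) u) / (LINT u|lborel. windowed_cf n 0 u))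
     \<longlonglongrightarrow> of_real (exp (- (1 / (2 * zeta3) powr (1/3)) * t\<^sup>2 / 2))" .
  have "\<forall>\<^sub>F n in sequentially. (LINT u|lborel. windowed_cf n (v n) u) / (LINT u|lborel. windowed_cf n 0 u) = char (pp_diff_law n) t"
    using eventually_gt_at_top[of 0]
  proof eventually_elim
    case (elim n)
    have s: "0 < saddle n" by (rule saddle_props)
    have "saddle n ^ 3 = saddle n powr 3" using s by (simp add: powr_numeral)
    then have "(saddle n ^ 3) powr (2/3) = saddle n powr (3 * (2/3))" by (simp only: powr_powr)
    also have "\<dots> = saddle n ^ 2" using s by simp
    finally have "(real n * saddle n ^ 3) powr (2/3) = real n powr (2/3) * saddle n ^ 2"
      using s elim by (simp add: powr_mult)
    then have "v n * saddle n ^ 2 = t / real n powr (2/3)" using s elim by (simp add: v_def)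
    then show ?case using counts_cf_ratio[of n "v n"] char_pp_diff_law[OF elim, of t] by simp
  qed
  with lim show ?thesis by (rule Lim_transform_eventually)
qed

lemma char_normal_density:
  assumes "0 < \<sigma>"
  shows "char (density lborel (normal_density 0 \<sigma>)) t = of_real (exp (- (\<sigma>\<^sup>2 * t\<^sup>2) / 2))"
proof -
  interpret prob_space std_normal_distribution
    by (rule prob_space_normal_density) simp
  have "distributed std_normal_distribution lborel (\<lambda>x. x) std_normal_density"
    by (auto simp: distributed_def intro!: distr_id2)
  from normal_density_affine[OF this, of \<sigma> 0] assms
  have "distributed std_normal_distribution lborel (\<lambda>x. \<sigma> * x) (normal_density 0 \<sigma>)" by simp
  then have e: "density lborel (normal_density 0 \<sigma>) = distr std_normal_distribution lborel (\<lambda>x. \<sigma> * x)"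
    by (rule distributed_distr_eq_density[symmetric])
  have "char (density lborel (normal_density 0 \<sigma>)) t = char std_normal_distribution (\<sigma> * t)"
    unfolding char_def e by (subst integral_distr) (auto simp: mult_ac)
  then show ?thesis by (simp add: char_std_normal_distribution power_mult_distrib)
qed

text \<open>\<open>normal_density\<close> is parametrised by the standard deviation, hence
  \<open>sqrt c\<close> for variance \<open>c\<close>; the index \<open>Suc n\<close> makes the
  sizes start at 1.\<close>

theorem theorem3:
  fixes c :: real
  assumes "c = 1 / (2 * zeta3) powr (1/3)"
  shows "weak_conv_m (\<lambda>n. pp_diff_law (Suc n)) (density lborel (normal_density 0 (sqrt c)))"
proof (rule levy_continuity)
  have c: "0 < c" using assms zeta3_pos by simp
  show "real_distribution (pp_diff_law (Suc n))" for n
    unfolding pp_diff_law_def by (intro prob_space.real_distribution_distr measure_pmf.prob_space_axioms) simp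
  show "real_distribution (density lborel (normal_density 0 (sqrt c)))"
    using prob_space_normal_density[of "sqrt c" 0] c
    by (auto simp: real_distribution_def real_distribution_axioms_def)
  show "(\<lambda>n. char (pp_diff_law (Suc n)) t) \<longlonglongrightarrow> char (density lborel (normal_density 0 (sqrt c))) t" for t
    using LIMSEQ_Suc[OF char_pp_diff_law_limit[of t]] c
    by (simp add: char_normal_density assms[symmetric])
qed

end
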